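(* Let $\mathcal{D}=(V,\mathcal{A})$ be a dypergraph, let $h,k,\alpha,\beta\in\mathbb{Z}_{>0}$, and let $\ell,\ell':\{1,\dots,k\}\to\mathbb{Z}_{>0}$ be such that $$\sum_{i=1}^k\ell'(i)\ \ge\ \beta\ \ge\ \alpha\ \ge\ \sum_{i=1}^k\ell(i),\qquad |V|\ge \ell'(i)\ge \ell(i)\ \text{ for every } 1\le i\le k.$$ There exists an $h$-regular $(\ell,\ell')$-bordered $(\alpha,\beta)$-limited packing of $k$ hyperbranchings in $\mathcal{D}$ if and only if all of the following hold: $$h|V|\ge\alpha,$$ $$\beta-\sum_{i=1}^k\ell(i)+\sum_{i=1}^k\min\{\ell(i),|\mathcal{P}|\}+e_{\mathcal{A}}(\mathcal{P})\ \ge\ h|\mathcal{P}|\quad\text{for every subpartition }\mathcal{P}\text{ of }V,$$ $$\sum_{i=1}^k\min\{\ell'(i),|\mathcal{P}|\}+e_{\mathcal{A}}(\mathcal{P})\ \ge\ h|\mathcal{P}|\quad\text{for every subpartition }\mathcal{P}\text{ of }V.$$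
   Context: All structures are finite with nonempty vertex set; parallel (hyper)arcs are allowed. A dypergraph (directed hypergraph) $\mathcal{D}=(V,\mathcal{A})$ has vertex set $V$ and a (multi)set $\mathcal{A}$ of hyperarcs; each hyperarc has exactly one head and at least one tail (tails are different from the head). A hyperarc enters $X\subseteq V$ if its head is in $X$ and at least one of its tails is not in $X$. A subpartition of $V$ is a family of pairwise disjoint nonempty subsets of $V$. For a subpartition $\mathcal{P}$ of $V$, $e_{\mathcal{A}}(\mathcal{P})$ is the number of hyperarcs in $\mathcal{A}$ that enter some member of $\mathcal{P}$. A digraph $(U,F)$ is a branching with root set $S$ (an $S$-branching) if $S\subseteq U$ and there is a unique path from $S$ to every $u\in U$; that is, it is a vertex-disjoint union of $|S|$ arborescences, each having exactly one vertex of $S$, which is its root. Trimming a hyperarc means replacing it by an arc $yx$ where $x$ is its head and $y$ is one of its tails. For a dypergraph $\mathcal{B}$, $V_{\ge1}(\mathcal{B})$ is the set of vertices of in-degree at least $1$ in $\mathcal{B}$ (i.e. heads of hyperarcs of $\mathcal{B}$). A dypergraph $\mathcal{B}=(U,\mathcal{F})$ is a hyperbranching with root set $S$ (an $S$-hyperbranching) if $S\subseteq U$ and the hyperarcs in $\mathcal{F}$ can be trimmed to an arc set $F$ such that $(V_{\ge1}(\mathcal{B})\cup S,F)$ is an $S$-branching. The core of $\mathcal{B}$ is $V_{\ge1}(\mathcal{B})\cup S$. A packing of $k$ hyperbranchings in $\mathcal{D}$ is a collection $\mathcal{B}_1,\dots,\mathcal{B}_k$ of pairwise hyperarc-disjoint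 subdypergraphs of $\mathcal{D}$, where $\mathcal{B}_i$ is an $S_i$-hyperbranching. It is $h$-regular if every vertex of $\mathcal{D}$ belongs to exactly $h$ of the cores; $(\ell,\ell')$-bordered if $\ell(i)\le|S_i|\le\ell'(i)$ for every $1\le i\le k$; and $(\alpha,\beta)$-limited if $\alpha\le\sum_{i=1}^k|S_i|\le\beta$. *)

theory Defs
  imports "Graph_Theory.Graph_Theory" "HOL-Library.Disjoint_Sets"
begin

(* Hyperarcs are identifiers, so parallel hyperarcs are allowed. *)
record ('v, 'e) dypergraph =
  hverts :: "'v set"
  hyperarcs :: "'e set"
  htails :: "'e \<Rightarrow> 'v set"
  hhead :: "'e \<Rightarrow> 'v"

locale dypergraph =
  fixes D :: "('v, 'e) dypergraph"
  assumes finite_hverts: "finite (hverts D)"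
    and hverts_nonempty: "hverts D \<noteq> {}"
    and finite_hyperarcs: "finite (hyperarcs D)"
    and hhead_in_hverts: "e \<in> hyperarcs D \<Longrightarrow> hhead D e \<in> hverts D"
    and htails_in_hverts: "e \<in> hyperarcs D \<Longrightarrow> htails D e \<subseteq> hverts D"
    and htails_nonempty: "e \<in> hyperarcs D \<Longrightarrow> htails D e \<noteq> {}"
    and hhead_notin_htails: "e \<in> hyperarcs D \<Longrightarrow> hhead D e \<notin> htails D e"

definition subdypergraph :: "('v, 'e) dypergraph \<Rightarrow> ('v, 'e) dypergraph \<Rightarrow> bool" where
  "subdypergraph B D \<longleftrightarrow> dypergraph B \<and> hverts B \<subseteq> hverts D \<and> hyperarcs B \<subseteq> hyperarcs D \<and>
     (\<forall>e\<in>hyperarcs B. htails B e = htails D e \<and> hhead B e = hhead D e)"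

definition enters :: "('v, 'e) dypergraph \<Rightarrow> 'e \<Rightarrow> 'v set \<Rightarrow> bool" where
  "enters D e X \<longleftrightarrow> hhead D e \<in> X \<and> \<not> htails D e \<subseteq> X"

definition subpartition :: "'v set \<Rightarrow> 'v set set \<Rightarrow> bool" where
  "subpartition V P \<longleftrightarrow> \<Union>P \<subseteq> V \<and> disjoint P \<and> {} \<notin> P"

definition entering_count :: "('v, 'e) dypergraph \<Rightarrow> 'v set set \<Rightarrow> nat" where
  "entering_count D P = card {e \<in> hyperarcs D. \<exists>X\<in>P. enters D e X}"

(* Uniqueness is among directed walks from S, which may repeat vertices: uniqueness of
   vertex-simple paths would still allow arcs entering a root. That this reading gives exactly
   the vertex-disjoint unions of arborescences rooted at the elements of S is proved below in
   branching_iff_arborescences. *)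
definition branching :: "('v, 'e) pre_digraph \<Rightarrow> 'v set \<Rightarrow> bool" where
  "branching G S \<longleftrightarrow> fin_digraph G \<and> verts G \<noteq> {} \<and> S \<subseteq> verts G \<and>
     (\<forall>u\<in>verts G. \<exists>!p. \<exists>s\<in>S. pre_digraph.awalk G s p u)"

definition arborescence :: "('v, 'e) pre_digraph \<Rightarrow> 'v \<Rightarrow> bool" where
  "arborescence G r \<longleftrightarrow> fin_digraph G \<and> r \<in> verts G \<and> in_degree G r = 0 \<and>
     (\<forall>v\<in>verts G - {r}. in_degree G v = 1) \<and> (\<forall>v\<in>verts G. r \<rightarrow>\<^sup>*\<^bsub>G\<^esub> v)"

lemma branching_iff_in_degree:
  "branching G S \<longleftrightarrow> fin_digraph G \<and> verts G \<noteq> {} \<and> S \<subseteq> verts G \<and>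
     (\<forall>v\<in>verts G. in_degree G v = (if v \<in> S then 0 else 1) \<and> (\<exists>s\<in>S. s \<rightarrow>\<^sup>*\<^bsub>G\<^esub> v))"
  (is "?L \<longleftrightarrow> ?R")
proof
  assume L: ?L
  then interpret fin_digraph G by (simp add: branching_def)
  have SV: "S \<subseteq> verts G" and ex1: "\<And>u. u \<in> verts G \<Longrightarrow> \<exists>!p. \<exists>s\<in>S. awalk s p u"
    using L by (auto simp: branching_def)
  have ext: "\<exists>p. \<exists>s\<in>S. awalk s (p @ [e]) (head G e)" if "e \<in> arcs G" for e
  proof -
    have "\<exists>p. \<exists>s\<in>S. awalk s p (tail G e)"
      using ex1[OF tail_in_verts[OF that]] by blast
    then obtain p s where "s \<in> S" "awalk s p (tail G e)" by blast
    then have "awalk s (p @ [e]) (head G e)"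
      using that by (auto simp: awalk_simps)
    with \<open>s \<in> S\<close> show ?thesis by blast
  qed
  have "in_degree G v = (if v \<in> S then 0 else 1) \<and> (\<exists>s\<in>S. s \<rightarrow>\<^sup>*\<^bsub>G\<^esub> v)" if v: "v \<in> verts G" for v
  proof
    show "\<exists>s\<in>S. s \<rightarrow>\<^sup>*\<^bsub>G\<^esub> v" using ex1[OF v] reachable_awalkI by blast
    show "in_degree G v = (if v \<in> S then 0 else 1)"
    proof (cases "v \<in> S")
      case True
      have "awalk v [] v" using v by (simp add: awalk_simps)
      with True have "in_arcs G v = {}"
        using ext ex1[OF v] unfolding in_arcs_def by blast
      with True show ?thesis by (simp add: in_degree_def)
    next
      case False
      obtain p s where p: "s \<in> S" "awalk s p v" using ex1[OF v] by blast
      with False have "p \<noteq> []" by (auto simp: awalk_simps)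
      then obtain q e where pe: "p = q @ [e]" by (metis rev_exhaust)
      have "in_arcs G v = {e}"
      proof
        show "{e} \<subseteq> in_arcs G v"
          using p pe by (auto simp: in_arcs_def awalk_simps)
        show "in_arcs G v \<subseteq> {e}"
        proof
          fix f assume "f \<in> in_arcs G v"
          then obtain r t where "t \<in> S" "awalk t (r @ [f]) v"
            using ext[of f] by (auto simp: in_arcs_def)
          then have "r @ [f] = p" using ex1[OF v] p by metis
          then show "f \<in> {e}" using pe by simp
        qed
      qed
      with False show ?thesis by (simp add: in_degree_def)
    qed
  qed
  then show ?R using L unfolding branching_def by blast
next
  assume R: ?R
  then interpret fin_digraph G by simp
  have deg: "\<And>v. v \<in> verts G \<Longrightarrow> in_degree G v = (if v \<in> S then 0 else 1)" using R by blast
  have uniq: "p = q" if "awalk s p u" "awalk t q u" "s \<in> S" "t \<in> S" for p q s t u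
    using that
  proof (induction p arbitrary: q u rule: rev_induct)
    case Nil
    then have "u \<in> verts G" "u \<in> S" by (auto simp: awalk_simps)
    then have "card (in_arcs G u) = 0" using deg[of u] by (simp add: in_degree_def)
    then have emp: "in_arcs G u = {}" using finite_in_arcs[of u] by simp
    show ?case
    proof (cases q rule: rev_exhaust)
      case (snoc r f)
      then have "f \<in> in_arcs G u" using \<open>awalk t q u\<close> by (simp add: in_arcs_def awalk_simps)
      with emp show ?thesis by simp
    qed simp
  next
    case (snoc e p)
    note IH = snoc.IH
    have e: "e \<in> in_arcs G u" "u \<in> verts G" "awalk s p (tail G e)"
      using snoc.prems by (auto simp: in_arcs_def awalk_simps)
    have "card (in_arcs G u) \<noteq> 0" using e(1) finite_in_arcs[of u] by (metis card_0_eq empty_iff)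
    then have "card (in_arcs G u) = 1" and uS: "u \<notin> S"
      using deg[OF e(2)] by (simp_all add: in_degree_def split: if_splits)
    then have one: "in_arcs G u = {e}" using e(1) by (metis card_1_singletonE singletonD)
    show ?case
    proof (cases q rule: rev_exhaust)
      case Nil
      then have "u \<in> S" using snoc.prems by (auto simp: awalk_simps)
      with uS show ?thesis ..
    next
      case (snoc r f)
      have f: "f \<in> in_arcs G u" "awalk t r (tail G f)"
        using \<open>awalk t q u\<close> snoc by (auto simp: in_arcs_def awalk_simps)
      with one have "f = e" by simp
      with f have "awalk t r (tail G e)" by simp
      then have "p = r" using IH[OF e(3)] \<open>s \<in> S\<close> \<open>t \<in> S\<close> by blast
      with snoc \<open>f = e\<close> show ?thesis by simp
    qed
  qed
  have "\<exists>!p. \<exists>s\<in>S. awalk s p u" if "u \<in> verts G" for u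
  proof -
    obtain s p where "s \<in> S" "awalk s p u" using R \<open>u \<in> verts G\<close> reachable_awalk by blast
    then show ?thesis by (metis uniq)
  qed
  then show ?L unfolding branching_def using R by blast
qed

lemma branching_iff_arborescences:
  assumes "fin_digraph G" "verts G \<noteq> {}" "S \<subseteq> verts G"
  shows "branching G S \<longleftrightarrow>
    (\<exists>T. (\<forall>s\<in>S. subgraph (T s) G \<and> arborescence (T s) s) \<and>
         disjoint_family_on (\<lambda>s. verts (T s)) S \<and>
         verts G = (\<Union>s\<in>S. verts (T s)) \<and> arcs G = (\<Union>s\<in>S. arcs (T s)))"
  (is "?L \<longleftrightarrow> (\<exists>T. ?R T)")
proof
  interpret fin_digraph G by fact
  assume L: ?L
  have deg: "in_degree G v = (if v \<in> S then 0 else 1)" and reach: "\<exists>s\<in>S. s \<rightarrow>\<^sup>*\<^bsub>G\<^esub> v"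
    if "v \<in> verts G" for v using L that unfolding branching_iff_in_degree by blast+
  have same: "s = t" if "s \<rightarrow>\<^sup>*\<^bsub>G\<^esub> v" "t \<rightarrow>\<^sup>*\<^bsub>G\<^esub> v" "s \<in> S" "t \<in> S" for s t v
  proof -
    obtain p q where pq: "awalk s p v" "awalk t q v" using \<open>s \<rightarrow>\<^sup>*\<^bsub>G\<^esub> v\<close> \<open>t \<rightarrow>\<^sup>*\<^bsub>G\<^esub> v\<close> by (auto simp: reachable_awalk)
    moreover have "v \<in> verts G" using pq by auto
    ultimately have "p = q" using L \<open>s \<in> S\<close> \<open>t \<in> S\<close> unfolding branching_def by blast
    with pq show ?thesis by (cases p) (auto simp: awalk_simps)
  qed
  define T where "T s = G \<restriction> {v. s \<rightarrow>\<^sup>*\<^bsub>G\<^esub> v}" for s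
  have vT: "verts (T s) = {v. s \<rightarrow>\<^sup>*\<^bsub>G\<^esub> v}" for s by (simp add: T_def)
  have step: "s \<rightarrow>\<^sup>*\<^bsub>G\<^esub> head G e" if "e \<in> arcs G" "s \<rightarrow>\<^sup>*\<^bsub>G\<^esub> tail G e" for s e
    using that reachable_adj_trans[OF that(2) in_arcs_imp_in_arcs_ends[OF that(1)]] by simp
  have aT: "arcs (T s) = {e \<in> arcs G. s \<rightarrow>\<^sup>*\<^bsub>G\<^esub> tail G e}" for s
    using step by (auto simp: T_def)
  have [simp]: "tail (T s) = tail G" "head (T s) = head G" for s by (simp_all add: T_def)
  have sub: "subgraph (T s) G" for s
    unfolding T_def by (rule induced_imp_subgraph, rule induced_induce)
       (auto dest: reachable_in_verts)
  have arb: "arborescence (T s) s" if s: "s \<in> S" for s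
  proof -
    interpret T: fin_digraph "T s" using sub by (rule fin_digraph_subgraph)
    have ss: "s \<in> verts G" "s \<in> verts (T s)" using s assms(3) by (auto simp: vT)
    have ind: "in_degree (T s) v = in_degree G v" if "v \<in> verts (T s)" for v
    proof -
      have "s \<rightarrow>\<^sup>*\<^bsub>G\<^esub> tail G e" if e: "e \<in> arcs G" "head G e = v" for e
      proof -
        obtain t where t: "t \<in> S" "t \<rightarrow>\<^sup>*\<^bsub>G\<^esub> tail G e" using reach[of "tail G e"] e by auto
        then have "t \<rightarrow>\<^sup>*\<^bsub>G\<^esub> v" using e step by blast
        then show ?thesis using same[of t v s] t s \<open>v \<in> verts (T s)\<close> by (auto simp: vT)
      qed
      then have "in_arcs (T s) v = in_arcs G v" by (auto simp: in_arcs_def aT)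
      then show ?thesis by (simp add: in_degree_def)
    qed
    have "in_degree G v = 1" if "v \<in> verts (T s) - {s}" for v
    proof -
      have v: "s \<rightarrow>\<^sup>*\<^bsub>G\<^esub> v" "v \<noteq> s" using that by (auto simp: vT)
      then have "v \<in> verts G" by (auto dest: reachable_in_verts)
      moreover from this have "v \<notin> S" using v same[of v v s] s by auto
      ultimately show ?thesis using deg by simp
    qed
    moreover have "s \<rightarrow>\<^sup>*\<^bsub>T s\<^esub> v" if v: "v \<in> verts (T s)" for v
    proof -
      have "s \<rightarrow>\<^sup>*\<^bsub>G\<^esub> v" using v by (simp add: vT)
      then have "s \<rightarrow>\<^sup>*\<^bsub>G\<^esub> v \<and> s \<rightarrow>\<^sup>*\<^bsub>T s\<^esub> v"
      proof (induction rule: reachable_induct)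
        case base
        then show ?case using ss by (auto intro!: T.reachable_refl)
      next
        case (step x y)
        then obtain e where e: "e \<in> arcs G" "tail G e = x" "head G e = y" by auto
        then have "e \<in> arcs (T s)" using step by (auto simp: aT)
        with e have "x \<rightarrow>\<^bsub>T s\<^esub> y" by (auto simp: arcs_ends_def arc_to_ends_def intro!: image_eqI)
        then show ?case using step by (auto intro: T.reachable_adj_trans reachable_adj_trans)
      qed
      then show ?thesis ..
    qed
    ultimately show ?thesis unfolding arborescence_def
      using ind ss s deg[of s] T.fin_digraph_axioms by auto
  qed
  have "?R T"
  proof (intro conjI ballI)
    show "disjoint_family_on (\<lambda>s. verts (T s)) S"
      using same by (auto simp: disjoint_family_on_def vT)
    show "verts G = (\<Union>s\<in>S. verts (T s))"
      using reach by (auto simp: vT dest: reachable_in_verts)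
    show "arcs G = (\<Union>s\<in>S. arcs (T s))"
      using reach by (auto simp: aT)
  qed (use sub arb in auto)
  then show "\<exists>T. ?R T" by (rule exI[of _ T])
next
  interpret fin_digraph G by fact
  assume "\<exists>T. ?R T"
  then obtain T where T: "?R T" ..
  have "in_degree G v = (if v \<in> S then 0 else 1) \<and> (\<exists>s\<in>S. s \<rightarrow>\<^sup>*\<^bsub>G\<^esub> v)" if vG: "v \<in> verts G" for v
  proof -
    obtain s where s: "s \<in> S" "v \<in> verts (T s)" using T vG by auto
    have sub: "subgraph (T t) G" and arb: "arborescence (T t) t" if "t \<in> S" for t
      using T that by auto
    have other: "t = s" if "t \<in> S" "v \<in> verts (T t)" for t
      using T s that unfolding disjoint_family_on_def by blast
    have vS: "v \<in> S \<longleftrightarrow> v = s" using other[of v] s(1) arb[of v] by (auto simp: arborescence_def)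
    have hd: "head (T t) e = head G e" if "t \<in> S" for t e
      using sub[OF that] by (auto simp: subgraph_def compatible_def)
    have hv: "head (T t) e \<in> verts (T t)" if "t \<in> S" "e \<in> arcs (T t)" for t e
      using arb[OF that(1)] that(2) wf_digraph.head_in_verts[of "T t" e]
      by (simp add: arborescence_def fin_digraph_def)
    have "in_arcs G v = in_arcs (T s) v"
    proof
      show "in_arcs (T s) v \<subseteq> in_arcs G v" using s(1) T hd[OF s(1)] by (auto simp: in_arcs_def)
      show "in_arcs G v \<subseteq> in_arcs (T s) v"
      proof
        fix e assume e: "e \<in> in_arcs G v"
        then obtain t where t: "t \<in> S" "e \<in> arcs (T t)" using T by (auto simp: in_arcs_def)
        then have "t = s" using e hv[OF t] hd[OF t(1)] other[OF t(1)] by (simp add: in_arcs_def)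
        then show "e \<in> in_arcs (T s) v" using t e hd[OF t(1), of e] by (simp add: in_arcs_def)
      qed
    qed
    then have "in_degree G v = in_degree (T s) v" by (simp add: in_degree_def)
    moreover have "in_degree (T s) v = (if v = s then 0 else 1)"
      using arb[OF s(1)] s(2) by (auto simp: arborescence_def)
    moreover have "s \<rightarrow>\<^sup>*\<^bsub>G\<^esub> v"
      using arb[OF s(1)] s(2) reachable_mono[OF _ sub[OF s(1)]] by (simp add: arborescence_def)
    ultimately show ?thesis using s vS by auto
  qed
  then show ?L unfolding branching_iff_in_degree using assms by blast
qed

(* The vertices of in-degree at least 1, together with the roots. *)
definition core :: "('v, 'e) dypergraph \<Rightarrow> 'v set \<Rightarrow> 'v set" where
  "core B S = hhead B ` hyperarcs B \<union> S"

(* The arc set obtained by trimming every hyperarc e to the arc from t e to its head. *)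
definition trimmed :: "('v, 'e) dypergraph \<Rightarrow> 'v set \<Rightarrow> ('e \<Rightarrow> 'v) \<Rightarrow> ('v, 'e) pre_digraph" where
  "trimmed B S t = \<lparr>verts = core B S, arcs = hyperarcs B, tail = t, head = hhead B\<rparr>"

definition hyperbranching :: "('v, 'e) dypergraph \<Rightarrow> 'v set \<Rightarrow> bool" where
  "hyperbranching B S \<longleftrightarrow> dypergraph B \<and> S \<subseteq> hverts B \<and>
     (\<exists>t. (\<forall>e\<in>hyperarcs B. t e \<in> htails B e) \<and> branching (trimmed B S t) S)"

definition hyperbranching_packing ::
  "('v, 'e) dypergraph \<Rightarrow> nat \<Rightarrow> (nat \<Rightarrow> ('v, 'e) dypergraph) \<Rightarrow> (nat \<Rightarrow> 'v set) \<Rightarrow> bool" where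
  "hyperbranching_packing D k B S \<longleftrightarrow>
     (\<forall>i\<in>{1..k}. subdypergraph (B i) D \<and> hyperbranching (B i) (S i)) \<and>
     disjoint_family_on (\<lambda>i. hyperarcs (B i)) {1..k}"

definition regular_packing ::
  "('v, 'e) dypergraph \<Rightarrow> nat \<Rightarrow> nat \<Rightarrow> (nat \<Rightarrow> ('v, 'e) dypergraph) \<Rightarrow> (nat \<Rightarrow> 'v set) \<Rightarrow> bool" where
  "regular_packing D h k B S \<longleftrightarrow>
     (\<forall>v\<in>hverts D. card {i \<in> {1..k}. v \<in> core (B i) (S i)} = h)"

definition bordered_packing ::
  "(nat \<Rightarrow> nat) \<Rightarrow> (nat \<Rightarrow> nat) \<Rightarrow> nat \<Rightarrow> (nat \<Rightarrow> 'v set) \<Rightarrow> bool" where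
  "bordered_packing l l' k S \<longleftrightarrow> (\<forall>i\<in>{1..k}. l i \<le> card (S i) \<and> card (S i) \<le> l' i)"

definition limited_packing :: "nat \<Rightarrow> nat \<Rightarrow> nat \<Rightarrow> (nat \<Rightarrow> 'v set) \<Rightarrow> bool" where
  "limited_packing \<alpha> \<beta> k S \<longleftrightarrow> \<alpha> \<le> (\<Sum>i=1..k. card (S i)) \<and> (\<Sum>i=1..k. card (S i)) \<le> \<beta>"

end

theory Submission
  imports Defs
begin

text \<open>Write \<open>\<rho>(X)\<close> for the number of hyperarcs entering \<open>X\<close>, and \<open>p(X) = h - \<rho>(X)\<close>, an intersecting
  supermodular function. A set \<open>X\<close> contains a vertex, which lies in \<open>h\<close> cores, and a core meeting \<open>X\<close> without
  a root in \<open>X\<close> uses a hyperarc entering \<open>X\<close>. So at least \<open>p(X)\<close> of the root sets meet \<open>X\<close>. Summing over the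
  members of a subpartition \<open>P\<close>, of which \<open>S i\<close> meets at most \<open>min (card (S i)) (card P)\<close>,
  gives necessity of the two conditions on subpartitions. Counting the roots by vertices gives
  the remaining one.

  Conversely, root sets for which every vertex has degree at most \<open>h\<close> (lies in at most \<open>h\<close> root sets)
  and every nonempty \<open>X\<close> meets at least \<open>p(X)\<close> of them can be grown into a packing one hyperarc at a
  time, as in Lovasz' proof of Edmonds' branching theorem (\<open>growth_step\<close>,
  \<open>packing_with_given_roots\<close>). It remains to find such root sets.

  Their sizes \<open>m i\<close> come from water filling between the bounds \<open>l\<close> and \<open>l'\<close>, with total
  \<open>min \<beta> (h * card V)\<close>. For each \<open>n\<close>, the sum of the \<open>min (m i) n\<close> then is as large as the upper bounds allow or
  as large as the total allows (\<open>balanced_sizes\<close>), and the conditions on subpartitions say precisely that in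
  both cases it is at least the sum of \<open>p\<close> over any subpartition with \<open>n\<close> members; if
  the total is \<open>h * card V\<close>, convexity replaces the condition with \<open>\<beta>\<close> (\<open>convex_deficit\<close>).

  The core of the proof is \<open>root_sets\<close>: this inequality already guarantees sets of sizes \<open>m i\<close> that cover
  \<open>p\<close>. The sets are chosen one by one, and each of them vertex by vertex. Call a member of a subpartition unhit if
  it is disjoint from the part chosen so far, and a subpartition tight if even the vertices still to be
  chosen can do no better than make its inequality an equality. The next vertex has to lie
  in an unhit member of every tight subpartition. Two tight subpartitions with different numbers of members
  cannot be uncrossed directly, because the right-hand side is only concave in this number. It is therefore
  replaced by its supporting lines: a tight subpartition minimises \<open>\<Sum>X\<in>P. f X + c\<close>
  for a slope \<open>c\<close>, where \<open>f\<close> is intersecting submodular. Minimisers for equal or different slopes uncross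
  well, and their unhit parts turn out to have a vertex in common (\<open>common_unhit_vertex\<close>).

  Finally the degrees are brought down to \<open>h\<close>. Since \<open>p\<close> is at most \<open>h\<close>, a vertex of degree above \<open>h\<close> has a root
  to spare, which moves to a vertex of degree below \<open>h\<close> (\<open>bounded_degree_cover\<close>).\<close>

section \<open>Uncrossing a set with a subpartition\<close>

definition intersecting_submodular :: "'v set \<Rightarrow> ('v set \<Rightarrow> int) \<Rightarrow> bool" where
  "intersecting_submodular V f \<longleftrightarrow>
     (\<forall>X Y. X \<subseteq> V \<longrightarrow> Y \<subseteq> V \<longrightarrow> X \<inter> Y \<noteq> {} \<longrightarrow> f (X \<union> Y) + f (X \<inter> Y) \<le> f X + f Y)"

lemma subpartition_finite:
  assumes "finite V" "subpartition V P"
  shows "finite P"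
  using assms unfolding subpartition_def by (meson finite_UnionD finite_subset)

lemma finite_subpartitions:
  assumes "finite V"
  shows "finite {P. subpartition V P}"
  by (rule finite_subset[of _ "Pow (Pow V)"]) (use assms in \<open>auto simp: subpartition_def\<close>)

lemma subpartition_mono: "subpartition V P \<Longrightarrow> Q \<subseteq> P \<Longrightarrow> subpartition V Q"
  unfolding subpartition_def by (meson Union_mono in_mono order_trans pairwise_subset)

lemma subpartition_exchange:
  assumes "subpartition V P" "subpartition V R" "\<Union>R \<inter> \<Union>(P - Q) = {}"
  shows "subpartition V ((P - Q) \<union> R)"
proof -
  have "X \<inter> Y = {}" if "X \<in> P - Q" "Y \<in> R" for X Y using assms(3) that by blast
  then have "disjoint ((P - Q) \<union> R)"
    using assms(1,2) unfolding subpartition_def disjoint_def by (metis DiffD1 Int_commute UnE)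
  then show ?thesis using assms(1,2) unfolding subpartition_def by auto
qed

lemma subpartition_disjoint:
  "subpartition V P \<Longrightarrow> X \<in> P \<Longrightarrow> Y \<in> P \<Longrightarrow> v \<in> X \<Longrightarrow> v \<in> Y \<Longrightarrow> X = Y"
  unfolding subpartition_def disjoint_def by blast

lemma subpartition_Union_Diff:
  assumes "subpartition V P" "Q \<subseteq> P"
  shows "\<Union>Q \<inter> \<Union>(P - Q) = {}"
proof -
  have False if "v \<in> X" "X \<in> Q" "v \<in> Y" "Y \<in> P" "Y \<notin> Q" for v X Y
    using subpartition_disjoint[OF assms(1), of X Y v] assms(2) that by auto
  then show ?thesis by blast
qed

lemma subpartition_meeting:
  assumes "subpartition V P" "C \<subseteq> V"
  defines "Q \<equiv> {X \<in> P. X \<inter> C \<noteq> {}}"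
  shows "subpartition V ((\<inter>) C ` Q)" "inj_on ((\<inter>) C) Q"
proof -
  have same: "X = Y" if "X \<in> Q" "Y \<in> Q" "C \<inter> X \<inter> (C \<inter> Y) \<noteq> {}" for X Y
    using that subpartition_disjoint[OF assms(1), of X Y] by (auto simp: Q_def)
  show "inj_on ((\<inter>) C) Q"
    using same by (intro inj_onI) (auto simp: Q_def)
  have "disjoint ((\<inter>) C ` Q)"
    unfolding disjoint_def using same by blast
  then show "subpartition V ((\<inter>) C ` Q)"
    using assms(2) by (auto simp: subpartition_def Q_def)
qed

text \<open>Uncrossing the centre \<open>C\<close> with the members of \<open>Q\<close> one after the other: the members are disjoint,
  so the part of the next one that lies in the set accumulated so far is just its part in \<open>C\<close>.\<close>

lemma star_uncrossing:
  assumes f: "intersecting_submodular V f"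
    and "C \<subseteq> V" "finite Q" "disjoint Q" "\<And>X. X \<in> Q \<Longrightarrow> X \<subseteq> V \<and> X \<inter> C \<noteq> {}"
  shows "f (C \<union> \<Union>Q) + (\<Sum>X\<in>Q. f (C \<inter> X)) \<le> f C + (\<Sum>X\<in>Q. f X)"
  using assms(3-5)
proof (induction Q)
  case (insert X Q)
  have "Q \<subseteq> Pow V" "disjoint Q" using insert.prems by (auto simp: pairwise_def)
  then have IH: "f (C \<union> \<Union>Q) + (\<Sum>X\<in>Q. f (C \<inter> X)) \<le> f C + (\<Sum>X\<in>Q. f X)"
    using insert.IH insert.prems(2) by simp
  have "X \<inter> \<Union>Q = {}"
    using insert.prems(1) insert.hyps(2) by (auto simp: pairwise_insert disjnt_def)
  then have inter: "(C \<union> \<Union>Q) \<inter> X = C \<inter> X" by blast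
  have "f ((C \<union> \<Union>Q) \<union> X) + f ((C \<union> \<Union>Q) \<inter> X) \<le> f (C \<union> \<Union>Q) + f X"
  proof -
    have "C \<union> \<Union>Q \<subseteq> V" "X \<subseteq> V" using \<open>C \<subseteq> V\<close> \<open>Q \<subseteq> Pow V\<close> insert.prems(2) by auto
    moreover have "(C \<union> \<Union>Q) \<inter> X \<noteq> {}" using insert.prems(2)[of X] inter by auto
    ultimately show ?thesis using f unfolding intersecting_submodular_def by blast
  qed
  moreover have "(C \<union> \<Union>Q) \<union> X = C \<union> \<Union>(insert X Q)" by blast
  ultimately show ?case using IH insert.hyps inter by simp
qed simp

section \<open>Cheapest subpartitions\<close>

text \<open>The surcharge \<open>c\<close> per member is a Lagrange multiplier for the number of members. It replaces
  a constraint that depends on the number of members in a concave way by a family of modular ones,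
  and it makes subpartitions of different cardinalities comparable.\<close>

definition price :: "('v set \<Rightarrow> int) \<Rightarrow> int \<Rightarrow> 'v set set \<Rightarrow> int" where
  "price f c P = (\<Sum>X\<in>P. f X + c)"

definition cheapest :: "'v set \<Rightarrow> ('v set \<Rightarrow> int) \<Rightarrow> int \<Rightarrow> 'v set set \<Rightarrow> bool" where
  "cheapest V f c P \<longleftrightarrow>
     subpartition V P \<and> (\<forall>Q. subpartition V Q \<longrightarrow> price f c P \<le> price f c Q)"

lemma price_alt: "price f c P = sum f P + int (card P) * c"
  by (simp add: price_def sum.distrib)

lemma price_exchange:
  assumes "finite V" "subpartition V P" "subpartition V R" "\<Union>R \<inter> \<Union>(P - Q) = {}" "Q \<subseteq> P"
  shows "price f c ((P - Q) \<union> R) = price f c P - price f c Q + price f c R"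
proof -
  have fin: "finite P" "finite R" using assms subpartition_finite by blast+
  have "{} \<notin> R" using assms(3) unfolding subpartition_def by blast
  then have "X \<notin> R" if "X \<in> P - Q" for X using assms(4) that by (metis Int_absorb Sup_upper disjoint_iff subset_empty subset_iff)
  then have "(P - Q) \<inter> R = {}" by blast
  then show ?thesis
    unfolding price_def using fin \<open>Q \<subseteq> P\<close>
    by (subst sum.union_disjoint) (auto simp: sum_diff)
qed

lemma cheapest_exchange:
  assumes "finite V" "cheapest V f c P" "subpartition V R" "\<Union>R \<inter> \<Union>(P - Q) = {}" "Q \<subseteq> P"
  shows "price f c Q \<le> price f c R"
    and "price f c R = price f c Q \<Longrightarrow> cheapest V f c ((P - Q) \<union> R)"
proof -
  have sub: "subpartition V P" using assms(2) by (simp add: cheapest_def)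
  have new: "subpartition V ((P - Q) \<union> R)"
    using subpartition_exchange[OF sub assms(3,4)] .
  have eq: "price f c ((P - Q) \<union> R) = price f c P - price f c Q + price f c R"
    using price_exchange[OF assms(1) sub assms(3-5)] .
  show "price f c Q \<le> price f c R"
    using assms(2) new eq unfolding cheapest_def by force
  show "cheapest V f c ((P - Q) \<union> R)" if "price f c R = price f c Q"
    using assms(2) new eq that unfolding cheapest_def by simp
qed

text \<open>A member \<open>A\<close> of a cheapest subpartition \<open>P'\<close> is uncrossed with the members \<open>Q\<close> of a cheapest
  subpartition \<open>P\<close> that it meets. In \<open>P\<close> the union \<open>A \<union> \<Union>Q\<close> may replace \<open>Q\<close>, in \<open>P'\<close> the traces of
  \<open>Q\<close> on \<open>A\<close> may replace \<open>A\<close>; neither exchange lowers the price. Added up, these two inequalities are the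
  reverse of the star inequality, except that the number of members moves \<open>card Q - 1\<close> times the
  difference of the surcharges from one side to the other. Hence the first claim, and if that
  correction vanishes, then all inequalities are equalities and both exchanges are again cheapest.
  The first claim says that \<open>A\<close> meets some member of \<open>P\<close> if \<open>c < c'\<close>, and at most one
  if \<open>c > c'\<close>.\<close>

lemma cheapest_uncross:
  assumes fin: "finite V" and f: "intersecting_submodular V f"
    and P: "cheapest V f c P" and P': "cheapest V f c' P'" and A: "A \<in> P'"
  defines "Q \<equiv> {X \<in> P. X \<inter> A \<noteq> {}}"
  shows "c' - c \<le> int (card Q) * (c' - c)"
    and "c = c' \<or> card Q = 1 \<Longrightarrow> cheapest V f c ((P - Q) \<union> {A \<union> \<Union>Q})"
    and "c = c' \<or> card Q = 1 \<Longrightarrow> cheapest V f c' ((P' - {A}) \<union> (\<inter>) A ` Q)"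
proof -
  have sP: "subpartition V P" and sP': "subpartition V P'"
    using P P' by (auto simp: cheapest_def)
  have AV: "A \<subseteq> V" "A \<noteq> {}" using sP' A unfolding subpartition_def by blast+
  have QP: "Q \<subseteq> P" by (auto simp: Q_def)
  have sQ: "subpartition V Q" using subpartition_mono[OF sP QP] .
  have finQ: "finite Q" using subpartition_finite[OF fin sQ] .
  have star: "f (A \<union> \<Union>Q) + (\<Sum>X\<in>Q. f (A \<inter> X)) \<le> f A + (\<Sum>X\<in>Q. f X)"
    by (rule star_uncrossing[OF f AV(1) finQ]) (use sQ in \<open>auto simp: subpartition_def Q_def\<close>)
  have top_sub: "subpartition V {A \<union> \<Union>Q}"
    using sQ AV unfolding subpartition_def by auto
  have top_dis: "\<Union>{A \<union> \<Union>Q} \<inter> \<Union>(P - Q) = {}"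
    using subpartition_Union_Diff[OF sP QP] by (auto simp: Q_def)
  have bot_sub: "subpartition V ((\<inter>) A ` Q)" and inj: "inj_on ((\<inter>) A) Q"
    using subpartition_meeting[OF sP AV(1)] by (auto simp: Q_def)
  have bot_dis: "\<Union>((\<inter>) A ` Q) \<inter> \<Union>(P' - {A}) = {}"
    using subpartition_Union_Diff[OF sP', of "{A}"] A by auto
  have price_bot: "price f c' ((\<inter>) A ` Q) = (\<Sum>X\<in>Q. f (A \<inter> X)) + int (card Q) * c'"
    using inj by (simp add: price_alt sum.reindex card_image)
  have le_top: "price f c Q \<le> f (A \<union> \<Union>Q) + c"
    using cheapest_exchange(1)[OF fin P top_sub top_dis QP] by (simp add: price_def)
  have le_bot: "f A + c' \<le> price f c' ((\<inter>) A ` Q)"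
    using cheapest_exchange(1)[OF fin P' bot_sub bot_dis] A by (simp add: price_def)
  show "c' - c \<le> int (card Q) * (c' - c)"
    using star le_top le_bot unfolding price_bot by (simp add: price_alt algebra_simps)
  assume cc: "c = c' \<or> card Q = 1"
  then have "c' - c = int (card Q) * (c' - c)" by auto
  then have "price f c {A \<union> \<Union>Q} = price f c Q" "price f c' ((\<inter>) A ` Q) = price f c' {A}"
    using star le_top le_bot unfolding price_bot by (simp_all add: price_alt algebra_simps)
  then show "cheapest V f c ((P - Q) \<union> {A \<union> \<Union>Q})"
    and "cheapest V f c' ((P' - {A}) \<union> (\<inter>) A ` Q)"
    using cheapest_exchange(2)[OF fin P top_sub top_dis QP]
      cheapest_exchange(2)[OF fin P' bot_sub bot_dis] A by auto
qed

section \<open>A vertex missed in every cheapest subpartition\<close>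

definition unhit :: "'v set \<Rightarrow> 'v set set \<Rightarrow> 'v set" where
  "unhit S P = \<Union>{X \<in> P. X \<inter> S = {}}"

definition least_unhit :: "'v set \<Rightarrow> ('v set \<Rightarrow> int) \<Rightarrow> 'v set \<Rightarrow> int \<Rightarrow> 'v set set \<Rightarrow> bool" where
  "least_unhit V f S c P \<longleftrightarrow> cheapest V f c P \<and>
     (\<forall>Q. cheapest V f c Q \<longrightarrow> \<not> unhit S Q \<subset> unhit S P)"

lemma least_unhit_exists:
  assumes "finite V" "cheapest V f c P\<^sub>0"
  obtains P where "least_unhit V f S c P"
proof -
  have "finite (unhit S ` {P. cheapest V f c P})"
    by (rule finite_imageI, rule finite_subset[OF _ finite_subpartitions[OF assms(1)]])
       (auto simp: cheapest_def)
  moreover have "unhit S ` {P. cheapest V f c P} \<noteq> {}" using assms(2) by blast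
  ultimately obtain U where U: "U \<in> unhit S ` {P. cheapest V f c P}"
    "\<And>W. W \<in> unhit S ` {P. cheapest V f c P} \<Longrightarrow> W \<subseteq> U \<Longrightarrow> U = W"
    using finite_has_minimal[of "unhit S ` {P. cheapest V f c P}"] by auto
  then obtain P where "cheapest V f c P" "U = unhit S P" by blast
  with U(2) have "least_unhit V f S c P" unfolding least_unhit_def by blast
  then show ?thesis using that by blast
qed

text \<open>If \<open>A\<close> were hit by \<open>S\<close>, then so would be \<open>A \<union> \<Union>Q\<close>, and putting this set in place of \<open>Q\<close> would remove \<open>B\<close>
  from the unhit part of \<open>P\<close>.\<close>

lemma unhit_if_meets_unhit:
  assumes fin: "finite V" and f: "intersecting_submodular V f"
    and P: "least_unhit V f S c P" and P': "cheapest V f c' P'" and A: "A \<in> P'"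
  defines "Q \<equiv> {X \<in> P. X \<inter> A \<noteq> {}}"
  assumes cc: "c = c' \<or> card Q = 1" and B: "B \<in> Q" "B \<inter> S = {}"
  shows "A \<inter> S = {}"
proof (rule ccontr)
  assume hit: "A \<inter> S \<noteq> {}"
  have cP: "cheapest V f c P" using P by (simp add: least_unhit_def)
  define R where "R = (P - Q) \<union> {A \<union> \<Union>Q}"
  have "cheapest V f c R"
    using cheapest_uncross(2)[OF fin f cP P' A] cc unfolding Q_def R_def by blast
  moreover have "unhit S R = unhit S (P - Q)" using hit unfolding unhit_def R_def by auto
  moreover have "B \<noteq> {}" "B \<subseteq> unhit S P"
    using B by (auto simp: unhit_def Q_def)
  moreover have "B \<inter> \<Union>(P - Q) = {}"
    using subpartition_Union_Diff[of V P Q] cP B(1) by (auto simp: cheapest_def Q_def)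
  then have "B \<inter> unhit S (P - Q) = {}" by (auto simp: unhit_def)
  moreover have "unhit S (P - Q) \<subseteq> unhit S P" by (auto simp: unhit_def)
  ultimately have "cheapest V f c R" "unhit S R \<subset> unhit S P" by auto
  then show False using P unfolding least_unhit_def by blast
qed

text \<open>Otherwise replacing \<open>A\<close> by its traces would shrink the unhit part of \<open>P'\<close>.\<close>

lemma unhit_covered:
  assumes fin: "finite V" and f: "intersecting_submodular V f"
    and P: "cheapest V f c P" and P': "least_unhit V f S c' P'" and A: "A \<in> P'"
  defines "Q \<equiv> {X \<in> P. X \<inter> A \<noteq> {}}"
  assumes cc: "c = c' \<or> card Q = 1" and unhit: "A \<inter> S = {}"
  shows "A \<subseteq> \<Union>Q"
proof (rule ccontr)
  assume not: "\<not> A \<subseteq> \<Union>Q"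
  have cP': "cheapest V f c' P'" using P' by (simp add: least_unhit_def)
  define R where "R = (P' - {A}) \<union> (\<inter>) A ` Q"
  have R: "cheapest V f c' R"
    using cheapest_uncross(3)[OF fin f P cP' A] cc unfolding Q_def R_def by blast
  moreover have "A \<inter> \<Union>(P' - {A}) = {}"
    using subpartition_Union_Diff[of V P' "{A}"] cP' A by (simp add: cheapest_def)
  moreover obtain x where "x \<in> A" "x \<notin> \<Union>Q" using not by blast
  ultimately have "x \<notin> unhit S R" "x \<in> unhit S P'"
    using A unhit by (auto simp: unhit_def R_def)
  moreover have "unhit S R \<subseteq> unhit S P'"
    using A unhit by (auto simp: unhit_def R_def)
  ultimately have "unhit S R \<subset> unhit S P'" by auto
  then show False using P' R unfolding least_unhit_def by blast
qed

text \<open>For one surcharge, inclusion-minimal unhit parts are therefore least: an unhit member of \<open>P\<close> is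
  covered by the members of \<open>P'\<close> that it meets, and all of these are unhit.\<close>

lemma least_unhit_least:
  assumes fin: "finite V" and f: "intersecting_submodular V f"
    and P: "least_unhit V f S c P" and P': "cheapest V f c P'"
  shows "unhit S P \<subseteq> unhit S P'"
proof
  fix v assume "v \<in> unhit S P"
  then obtain B where B: "B \<in> P" "B \<inter> S = {}" "v \<in> B" unfolding unhit_def by blast
  have "B \<subseteq> \<Union>{X \<in> P'. X \<inter> B \<noteq> {}}"
    using unhit_covered[OF fin f P' P B(1)] B(2) by blast
  then obtain A where A: "A \<in> P'" "v \<in> A" using B(3) by blast
  have "A \<inter> S = {}"
    by (rule unhit_if_meets_unhit[OF fin f P P' A(1), of B]) (use B A in auto)
  then show "v \<in> unhit S P'" using A unfolding unhit_def by blast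
qed

text \<open>Between different surcharges there is no such comparison of the unhit parts, but they are nested
  locally: \<open>B\<close> meets some member \<open>A\<close> of \<open>P\<close> since the surcharge is smaller there, and \<open>A\<close> meets no
  other member of \<open>P'\<close>. Uncrossing the pair \<open>A\<close>, \<open>B\<close> gives that \<open>A\<close> is unhit and then that
  \<open>A \<subseteq> B\<close>.\<close>

lemma least_unhit_refines:
  assumes fin: "finite V" and f: "intersecting_submodular V f"
    and P: "least_unhit V f S c P" and P': "least_unhit V f S c' P'" and "c < c'"
    and B: "B \<in> P'" "B \<inter> S = {}"
  obtains A where "A \<in> P" "A \<subseteq> B"
proof -
  have cP: "cheapest V f c P" and cP': "cheapest V f c' P'"
    using P P' by (simp_all add: least_unhit_def)
  have "c' - c \<le> int (card {X \<in> P. X \<inter> B \<noteq> {}}) * (c' - c)"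
    using cheapest_uncross(1)[OF fin f cP cP' B(1)] .
  then have "card {X \<in> P. X \<inter> B \<noteq> {}} \<noteq> 0" using \<open>c < c'\<close> by (intro notI) simp
  then obtain A where A: "A \<in> P" "A \<inter> B \<noteq> {}" by (metis (mono_tags, lifting) card.empty empty_Collect_eq)
  define Q where "Q = {X \<in> P'. X \<inter> A \<noteq> {}}"
  have BQ: "B \<in> Q" using A B by (auto simp: Q_def)
  have finQ: "finite Q" using subpartition_finite[OF fin] cP' by (simp add: Q_def cheapest_def)
  have "c - c' \<le> int (card Q) * (c - c')"
    using cheapest_uncross(1)[OF fin f cP' cP A(1)] unfolding Q_def .
  then have "(int (card Q) - 1) * (c' - c) \<le> 0" by (simp add: algebra_simps)
  then have "card Q \<le> 1" using \<open>c < c'\<close> by (simp add: mult_le_0_iff)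
  moreover have "card Q \<noteq> 0" using BQ finQ by auto
  ultimately have one: "card Q = 1" by simp
  then have Q: "Q = {B}" using BQ by (metis card_1_singletonE singletonD)
  have "A \<inter> S = {}"
    by (rule unhit_if_meets_unhit[OF fin f P' cP A(1), of B])
       (use BQ B one in \<open>auto simp: Q_def\<close>)
  then have "A \<subseteq> \<Union>Q"
    using unhit_covered[OF fin f cP' P A(1)] one unfolding Q_def by blast
  then show ?thesis using that A(1) Q by simp
qed

text \<open>Descending through the surcharges from the largest to the smallest, each step passes from an
  unhit member to an unhit member inside it. The set reached at the end lies in the least
  unhit part of every surcharge, so any of its vertices will do.\<close>

lemma common_unhit_vertex:
  assumes fin: "finite V" and f: "intersecting_submodular V f"
    and L: "finite L" "L \<noteq> {}"
    and cheap: "\<And>c. c \<in> L \<Longrightarrow> \<exists>P. cheapest V f c P"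
    and ne: "\<And>c P. c \<in> L \<Longrightarrow> cheapest V f c P \<Longrightarrow> unhit S P \<noteq> {}"
  obtains v where "\<And>c P. c \<in> L \<Longrightarrow> cheapest V f c P \<Longrightarrow> v \<in> unhit S P"
proof -
  have "\<forall>c\<in>L. \<exists>P. least_unhit V f S c P"
    using cheap least_unhit_exists[OF fin] by metis
  then obtain M where M: "\<And>c. c \<in> L \<Longrightarrow> least_unhit V f S c (M c)" by metis
  have "L \<noteq> {} \<longrightarrow> (\<exists>B\<in>M (Min L). B \<inter> S = {} \<and> (\<forall>c\<in>L. B \<subseteq> unhit S (M c)))"
    using L(1) M ne
  proof (induction L rule: finite_linorder_min_induct)
    case (insert b L)
    have Mb: "least_unhit V f S b (M b)" using insert.prems(1) by simp
    have min: "Min (insert b L) = b"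
      using insert.hyps by (intro Min_eqI) (auto intro: less_imp_le)
    have "\<exists>A\<in>M b. A \<inter> S = {} \<and> (\<forall>c\<in>L. A \<subseteq> unhit S (M c))"
    proof (cases "L = {}")
      case True
      have "unhit S (M b) \<noteq> {}" using insert.prems(2)[of b] Mb by (simp add: least_unhit_def)
      then show ?thesis using True unfolding unhit_def by blast
    next
      case False
      then obtain B where B: "B \<in> M (Min L)" "B \<inter> S = {}" "\<And>c. c \<in> L \<Longrightarrow> B \<subseteq> unhit S (M c)"
        using insert by (metis insert_iff)
      have "Min L \<in> L" using False insert.hyps by simp
      then obtain A where "A \<in> M b" "A \<subseteq> B"
        using least_unhit_refines[OF fin f Mb insert.prems(1)[of "Min L"] _ B(1,2)] insert.hyps
        by (metis insertI2)
      then show ?thesis using B(2,3) by (meson disjoint_iff order_trans subset_iff)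
    qed
    then obtain A where A: "A \<in> M b" "A \<inter> S = {}" "\<And>c. c \<in> L \<Longrightarrow> A \<subseteq> unhit S (M c)" by blast
    moreover have "A \<subseteq> unhit S (M b)" using A(1,2) unfolding unhit_def by blast
    ultimately show ?case unfolding min by (intro impI bexI[of _ A]) auto
  qed simp
  then obtain B where B: "B \<in> M (Min L)" "\<And>c. c \<in> L \<Longrightarrow> B \<subseteq> unhit S (M c)" using L(2) by blast
  have "Min L \<in> L" using L by simp
  then have "B \<noteq> {}" using M[of "Min L"] B(1)
    unfolding least_unhit_def cheapest_def subpartition_def by blast
  then obtain v where "v \<in> B" by blast
  show ?thesis
  proof (rule that)
    fix c P assume "c \<in> L" "cheapest V f c P"
    then have "B \<subseteq> unhit S P" using B(2)[of c] least_unhit_least[OF fin f M] by (meson order_trans)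
    then show "v \<in> unhit S P" using \<open>v \<in> B\<close> by blast
  qed
qed

section \<open>Root sets of prescribed sizes covering a supermodular function\<close>

definition hits :: "'v set \<Rightarrow> 'v set set \<Rightarrow> nat" where
  "hits S P = card {X \<in> P. X \<inter> S \<noteq> {}}"

lemma sum_hit:
  assumes "finite P"
  shows "(\<Sum>X\<in>P. if X \<inter> S = {} then 0 else 1) = int (hits S P)"
proof -
  have "{X \<in> P. X \<inter> S \<noteq> {}} = P \<inter> - {X. X \<inter> S = {}}" by auto
  then show ?thesis using assms by (simp add: hits_def sum.If_cases)
qed

text \<open>Being met by \<open>S\<close> is a submodular property of sets. Thus choosing \<open>S\<close> as one of the root sets leaves a
  covering problem for a function that is still intersecting supermodular.\<close>

lemma hit_minus_supermodular:
  assumes "intersecting_submodular V (\<lambda>X. - p X)"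
  shows "intersecting_submodular V (\<lambda>X. (if X \<inter> S = {} then 0 else 1) - p X)"
  unfolding intersecting_submodular_def
proof (intro allI impI)
  fix X Y assume XY: "X \<subseteq> V" "Y \<subseteq> V" "X \<inter> Y \<noteq> {}"
  define hit :: "'a set \<Rightarrow> int" where "hit X = (if X \<inter> S = {} then 0 else 1)" for X
  have "hit (X \<union> Y) + hit (X \<inter> Y) \<le> hit X + hit Y" by (auto simp: hit_def)
  moreover have "- p (X \<union> Y) + - p (X \<inter> Y) \<le> - p X + - p Y"
    using assms XY unfolding intersecting_submodular_def by blast
  ultimately have "hit (X \<union> Y) - p (X \<union> Y) + (hit (X \<inter> Y) - p (X \<inter> Y)) \<le> hit X - p X + (hit Y - p Y)"
    by linarith
  then show "(if (X \<union> Y) \<inter> S = {} then 0 else 1) - p (X \<union> Y) + ((if X \<inter> Y \<inter> S = {} then 0 else 1) - p (X \<inter> Y))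
    \<le> (if X \<inter> S = {} then 0 else 1) - p X + ((if Y \<inter> S = {} then 0 else 1) - p Y)"
    unfolding hit_def .
qed

text \<open>The forward difference of a concave function is the slope of a line above it; this slope is the
  surcharge at which a tight subpartition becomes a cheapest one.\<close>

lemma concave_supergradient:
  fixes g :: "nat \<Rightarrow> int"
  assumes "\<And>n. g (Suc (Suc n)) - g (Suc n) \<le> g (Suc n) - g n"
  shows "g n' \<le> g n + (g (Suc n) - g n) * (int n' - int n)"
proof -
  define d where "d n = g (Suc n) - g n" for n
  have anti: "d j \<le> d i" if "i \<le> j" for i j
    using lift_Suc_antimono_le[of d i j] assms that by (simp add: d_def)
  have up: "g (n + j) \<le> g n + d n * int j" for j
  proof (induction j)
    case (Suc j)
    have "g (n + Suc j) = g (n + j) + d (n + j)" by (simp add: d_def)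
    with Suc anti[of n "n + j"] show ?case by (simp add: algebra_simps)
  qed simp
  have down: "g (n - j) \<le> g n - d n * int j" if "j \<le> n" for j
    using that
  proof (induction j)
    case (Suc j)
    have "g (n - j) = g (n - Suc j) + d (n - Suc j)"
      using Suc.prems by (simp add: d_def Suc_diff_Suc)
    with Suc anti[of "n - Suc j" n] show ?case by (simp add: algebra_simps)
  qed simp
  show ?thesis
  proof (cases "n \<le> n'")
    case True
    then show ?thesis using up[of "n' - n"] by (simp add: d_def of_nat_diff)
  next
    case False
    then show ?thesis using down[of "n - n'"] by (simp add: d_def of_nat_diff algebra_simps)
  qed
qed

text \<open>The set \<open>S\<close> may still get \<open>r + 1\<close> vertices. Adding \<open>v\<close> is harmful only for a tight subpartition of which
  \<open>v\<close> lies in no unhit member. By concavity of \<open>g\<close>, a tight subpartition with \<open>n\<close> members is a cheapest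
  one at the surcharge \<open>g (n + 1) - g n\<close>. Conversely, at this surcharge every cheapest subpartition
  has an unhit member: the future vertices have to make good a deficit of \<open>r + 1\<close>, and
  by \<open>room\<close> this does not exceed the number of members not hit so far. So the vertex common to all
  unhit parts exists and can be added.\<close>

lemma next_root:
  fixes g :: "nat \<Rightarrow> int"
  assumes fin: "finite V" and p: "intersecting_submodular V (\<lambda>X. - p X)"
    and concave: "\<And>n. g (Suc (Suc n)) - g (Suc n) \<le> g (Suc n) - g n"
    and room: "\<And>P. subpartition V P \<Longrightarrow> sum p P - g (card P) \<le> int (card P)"
    and cover: "\<And>P. subpartition V P \<Longrightarrow> sum p P - g (card P) \<le> int (Suc r) + int (hits S P)"
    and "S \<subset> V"
  obtains v where "v \<in> V - S"
    and "\<And>P. subpartition V P \<Longrightarrow> sum p P - g (card P) \<le> int r + int (hits (insert v S) P)"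
proof -
  define f where "f X = (if X \<inter> S = {} then 0 else 1) - p X" for X
  have f: "intersecting_submodular V f" unfolding f_def by (rule hit_minus_supermodular[OF p])
  have price: "price f c P = int (hits S P) - sum p P + int (card P) * c" if "subpartition V P" for c P
    using sum_hit[OF subpartition_finite[OF fin that]]
    by (simp add: price_alt f_def sum_subtractf)
  define tight where
    "tight P \<longleftrightarrow> subpartition V P \<and> sum p P - g (card P) = int (Suc r) + int (hits S P)" for P
  define slope where "slope P = g (Suc (card P)) - g (card P)" for P :: "'a set set"
  have grad: "g n \<le> g (card P) + slope P * (int n - int (card P))" for n P
    using concave_supergradient[of g, OF concave] by (simp add: slope_def)
  have cheap: "cheapest V f (slope P) P" if "tight P" for P
    unfolding cheapest_def
  proof (intro conjI allI impI)
    show sub: "subpartition V P" using that by (simp add: tight_def)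
    fix Q assume Q: "subpartition V Q"
    show "price f (slope P) P \<le> price f (slope P) Q"
      using that cover[OF Q] grad[of "card Q" P] unfolding price[OF Q] price[OF sub] tight_def
      by (simp add: algebra_simps)
  qed
  have ne: "unhit S Q \<noteq> {}" if P: "tight P" and Q: "cheapest V f (slope P) Q" for P Q
  proof
    assume "unhit S Q = {}"
    have sub: "subpartition V Q" and subP: "subpartition V P"
      using Q P by (auto simp: cheapest_def tight_def)
    have "{X \<in> Q. X \<inter> S \<noteq> {}} = Q"
      using \<open>unhit S Q = {}\<close> sub unfolding unhit_def subpartition_def by auto
    then have all: "hits S Q = card Q" by (simp add: hits_def)
    have "price f (slope P) Q \<le> price f (slope P) P"
      using Q subP by (simp add: cheapest_def)
    then show False
      using P room[OF sub] grad[of "card Q" P] unfolding price[OF sub] price[OF subP] tight_def all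
      by (simp add: algebra_simps)
  qed
  show ?thesis
  proof (cases "\<exists>P. tight P")
    case False
    obtain v where v: "v \<in> V - S" using \<open>S \<subset> V\<close> by blast
    show ?thesis
    proof (rule that[OF v])
      fix P assume P: "subpartition V P"
      have "hits S P \<le> hits (insert v S) P"
        unfolding hits_def by (rule card_mono) (use subpartition_finite[OF fin P] in auto)
      then show "sum p P - g (card P) \<le> int r + int (hits (insert v S) P)"
        using cover[OF P] False P unfolding tight_def by force
    qed
  next
    case True
    have "finite {P. tight P}"
      by (rule finite_subset[OF _ finite_subpartitions[OF fin]]) (auto simp: tight_def)
    then have "finite (slope ` {P. tight P})" "slope ` {P. tight P} \<noteq> {}" using True by auto
    then obtain v where v: "\<And>c P. c \<in> slope ` {P. tight P} \<Longrightarrow> cheapest V f c P \<Longrightarrow> v \<in> unhit S P"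
      using common_unhit_vertex[OF fin f, of "slope ` {P. tight P}" S] cheap ne by (metis (no_types, lifting) image_iff mem_Collect_eq)
    have vt: "v \<in> unhit S P" if "tight P" for P
      using v[of "slope P" P] cheap[OF that] that by blast
    have "v \<in> V - S"
    proof -
      obtain P where "tight P" using True ..
      then have "v \<in> unhit S P" "subpartition V P" using vt by (auto simp: tight_def)
      then show ?thesis by (auto simp: unhit_def subpartition_def)
    qed
    then show ?thesis
    proof (rule that)
      fix P assume P: "subpartition V P"
      have finP: "finite P" using subpartition_finite[OF fin P] .
      have mono: "{X \<in> P. X \<inter> S \<noteq> {}} \<subseteq> {X \<in> P. X \<inter> insert v S \<noteq> {}}" by blast
      show "sum p P - g (card P) \<le> int r + int (hits (insert v S) P)"
      proof (cases "tight P")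
        case True
        then obtain X where "X \<in> P" "X \<inter> S = {}" "v \<in> X" using vt unfolding unhit_def by blast
        then have "{X \<in> P. X \<inter> S \<noteq> {}} \<subset> {X \<in> P. X \<inter> insert v S \<noteq> {}}" using mono by blast
        then have "hits S P < hits (insert v S) P"
          unfolding hits_def by (rule psubset_card_mono[rotated]) (use finP in simp)
        then show ?thesis using cover[OF P] by simp
      next
        case False
        have "hits S P \<le> hits (insert v S) P"
          unfolding hits_def by (rule card_mono[OF _ mono]) (use finP in simp)
        then show ?thesis using cover[OF P] False P unfolding tight_def by force
      qed
    qed
  qed
qed

text \<open>One root set is split off. Here \<open>g\<close> stands for what the other root sets are able to hit, which
  is why it is concave.\<close>

lemma root_set:
  fixes g :: "nat \<Rightarrow> int"
  assumes fin: "finite V" and p: "intersecting_submodular V (\<lambda>X. - p X)"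
    and concave: "\<And>n. g (Suc (Suc n)) - g (Suc n) \<le> g (Suc n) - g n"
    and cover: "\<And>P. subpartition V P \<Longrightarrow> sum p P \<le> g (card P) + int (min m (card P))"
    and "m \<le> card V"
  obtains S where "S \<subseteq> V" "card S = m"
    "\<And>P. subpartition V P \<Longrightarrow> sum p P \<le> g (card P) + int (hits S P)"
proof -
  have room: "sum p P - g (card P) \<le> int (card P)" if "subpartition V P" for P
    using cover[OF that] by linarith
  have "\<exists>S\<subseteq>V. card S = j \<and>
      (\<forall>P. subpartition V P \<longrightarrow> sum p P - g (card P) \<le> int (m - j) + int (hits S P))" if "j \<le> m" for j
    using that
  proof (induction j)
    case 0
    show ?case
    proof (intro exI[of _ "{}"] conjI allI impI)
      fix P assume "subpartition V P"
      then show "sum p P - g (card P) \<le> int (m - 0) + int (hits {} P)"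
        using cover[of P] by simp
    qed simp_all
  next
    case (Suc j)
    then obtain S where S: "S \<subseteq> V" "card S = j"
      "\<And>P. subpartition V P \<Longrightarrow> sum p P - g (card P) \<le> int (m - j) + int (hits S P)"
      by auto
    have "S \<subset> V" using S(1,2) Suc.prems \<open>m \<le> card V\<close> by auto
    have "m - j = Suc (m - Suc j)" using Suc.prems by simp
    then obtain v where v: "v \<in> V - S"
      "\<And>P. subpartition V P \<Longrightarrow> sum p P - g (card P) \<le> int (m - Suc j) + int (hits (insert v S) P)"
      using next_root[OF fin p concave room _ \<open>S \<subset> V\<close>, of "m - Suc j"] S(3) by metis
    have "finite S" using finite_subset[OF S(1) fin] .
    then show ?case using S(1,2) v by (intro exI[of _ "insert v S"]) auto
  qed
  from this[of m] obtain S where "S \<subseteq> V" "card S = m"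
    "\<And>P. subpartition V P \<Longrightarrow> sum p P - g (card P) \<le> int (hits S P)" by auto
  then show ?thesis using that[of S] by (simp add: algebra_simps)
qed

text \<open>A Hall-type theorem: \<open>m i\<close> vertices can hit at most \<open>min (m i) (card P)\<close> members of \<open>P\<close>, and this
  obvious necessary condition suffices.\<close>

lemma root_sets:
  assumes fin: "finite V" and "finite K" and p: "intersecting_submodular V (\<lambda>X. - p X)"
    and "\<And>i. i \<in> K \<Longrightarrow> m i \<le> card V"
    and "\<And>P. subpartition V P \<Longrightarrow> sum p P \<le> (\<Sum>i\<in>K. int (min (m i) (card P)))"
  obtains S where "\<And>i. i \<in> K \<Longrightarrow> S i \<subseteq> V \<and> card (S i) = m i"
    and "\<And>X. X \<subseteq> V \<Longrightarrow> X \<noteq> {} \<Longrightarrow> p X \<le> int (card {i \<in> K. X \<inter> S i \<noteq> {}})"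
proof -
  have "\<exists>S. (\<forall>i\<in>K. S i \<subseteq> V \<and> card (S i) = m i) \<and>
      (\<forall>X. X \<subseteq> V \<longrightarrow> X \<noteq> {} \<longrightarrow> p X \<le> int (card {i \<in> K. X \<inter> S i \<noteq> {}}))"
    using assms(2-5)
  proof (induction K arbitrary: p)
    case empty
    have "p X \<le> 0" if "X \<subseteq> V" "X \<noteq> {}" for X
      using empty(3)[of "{X}"] that by (simp add: subpartition_def)
    then show ?case by simp
  next
    case (insert k K)
    define g where "g n = (\<Sum>i\<in>K. int (min (m i) n))" for n
    have concave: "g (Suc (Suc n)) - g (Suc n) \<le> g (Suc n) - g n" for n
      unfolding g_def sum_subtractf[symmetric] by (rule sum_mono) (auto simp: min_def)
    have "sum p P \<le> g (card P) + int (min (m k) (card P))" if "subpartition V P" for P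
      using insert.prems(3)[OF that] insert.hyps by (simp add: g_def)
    then obtain S where S: "S \<subseteq> V" "card S = m k"
      "\<And>P. subpartition V P \<Longrightarrow> sum p P \<le> g (card P) + int (hits S P)"
      using root_set[where V = V and p = p and g = g and m = "m k"] fin concave insert.prems(1,2)
      by (metis insertI1)
    define q where "q X = p X - (if X \<inter> S = {} then 0 else 1)" for X
    have "intersecting_submodular V (\<lambda>X. - q X)"
      using hit_minus_supermodular[OF insert.prems(1), of S] by (simp add: q_def)
    moreover have "sum q P \<le> (\<Sum>i\<in>K. int (min (m i) (card P)))" if "subpartition V P" for P
      using S(3)[OF that] sum_hit[OF subpartition_finite[OF fin that], of S]
      by (simp add: q_def sum_subtractf g_def)
    ultimately obtain T where T: "\<forall>i\<in>K. T i \<subseteq> V \<and> card (T i) = m i"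
      "\<And>X. X \<subseteq> V \<Longrightarrow> X \<noteq> {} \<Longrightarrow> q X \<le> int (card {i \<in> K. X \<inter> T i \<noteq> {}})"
      using insert.IH[of q] insert.prems(2) by auto
    have "p X \<le> int (card {i \<in> insert k K. X \<inter> (T(k := S)) i \<noteq> {}})" if X: "X \<subseteq> V" "X \<noteq> {}" for X
    proof -
      have "{i \<in> insert k K. X \<inter> (T(k := S)) i \<noteq> {}} =
          {i \<in> K. X \<inter> T i \<noteq> {}} \<union> (if X \<inter> S = {} then {} else {k})"
        using insert.hyps(2) by auto
      then show ?thesis using T(2)[OF X] insert.hyps by (simp add: q_def split: if_splits)
    qed
    then show ?case
      using T(1) S(1,2) insert.hyps(2) by (intro exI[of _ "T(k := S)"]) auto
  qed
  then show ?thesis using that by blast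
qed

section \<open>Sizes and degrees of the root sets\<close>

text \<open>Water filling: starting from \<open>l\<close>, always increase a smallest value that has not reached its
  upper bound. Then a value above its lower bound exceeds no unsaturated value by more than one.
  For given \<open>n\<close>, either every unsaturated value is at least \<open>n\<close>, and truncation at \<open>n\<close> cannot tell
  \<open>m\<close> from \<open>l'\<close>; or some unsaturated value is below \<open>n\<close>, hence all increased values are at most
  \<open>n\<close> and none of the \<open>s - sum l K\<close> units is lost by truncation.\<close>

lemma balanced_sizes:
  fixes l l' :: "'i \<Rightarrow> nat"
  assumes "finite K" and le: "\<And>i. i \<in> K \<Longrightarrow> l i \<le> l' i"
    and "sum l K \<le> s" "s \<le> sum l' K"
  obtains m where "\<And>i. i \<in> K \<Longrightarrow> l i \<le> m i \<and> m i \<le> l' i" and "sum m K = s"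
    and "\<And>n. (\<Sum>i\<in>K. min (m i) n) = (\<Sum>i\<in>K. min (l' i) n) \<or>
      (\<Sum>i\<in>K. min (m i) n) + sum l K = s + (\<Sum>i\<in>K. min (l i) n)"
proof -
  have "\<exists>m. (\<forall>i\<in>K. l i \<le> m i \<and> m i \<le> l' i) \<and> sum m K = sum l K + d \<and>
      (\<forall>i\<in>K. \<forall>j\<in>K. l i < m i \<longrightarrow> m j < l' j \<longrightarrow> m i \<le> Suc (m j))"
    if "sum l K + d \<le> sum l' K" for d
    using that
  proof (induction d)
    case 0
    show ?case by (rule exI[of _ l]) (simp add: le)
  next
    case (Suc d)
    then obtain m where m: "\<forall>i\<in>K. l i \<le> m i \<and> m i \<le> l' i" "sum m K = sum l K + d"
      "\<forall>i\<in>K. \<forall>j\<in>K. l i < m i \<longrightarrow> m j < l' j \<longrightarrow> m i \<le> Suc (m j)" by auto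
    define J where "J = {j \<in> K. m j < l' j}"
    have "J \<noteq> {}"
    proof
      assume "J = {}"
      then have "sum l' K \<le> sum m K" unfolding J_def by (intro sum_mono) force
      then show False using m(2) Suc.prems by simp
    qed
    moreover have "finite J" using \<open>finite K\<close> by (simp add: J_def)
    ultimately obtain j where j: "j \<in> J" "\<And>i. i \<in> J \<Longrightarrow> m j \<le> m i"
      by (metis arg_min_if_finite(1) arg_min_least)
    define m' where "m' = m(j := Suc (m j))"
    have jK: "j \<in> K" "m j < l' j" using j(1) by (auto simp: J_def)
    have "sum m' K = Suc (sum m K)"
      unfolding m'_def using \<open>finite K\<close> jK(1) by (simp add: sum.remove[of K j])
    moreover have "\<forall>i\<in>K. l i \<le> m' i \<and> m' i \<le> l' i"
      using m(1) jK by (auto simp: m'_def le_Suc_eq Suc_leI)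
    moreover have "m' i \<le> Suc (m' i')"
      if "i \<in> K" "i' \<in> K" "l i < m' i" "m' i' < l' i'" for i i'
    proof -
      have "m i' < l' i'" "m i' \<le> m' i'" using that(4) by (auto simp: m'_def split: if_splits)
      moreover have "m j \<le> m i'" using j(2)[of i'] that(2) calculation(1) by (simp add: J_def)
      moreover have "m i \<le> Suc (m i')" if "i \<noteq> j"
        using m(3) \<open>i \<in> K\<close> \<open>i' \<in> K\<close> \<open>l i < m' i\<close> calculation(1) that by (simp add: m'_def)
      ultimately show ?thesis by (auto simp: m'_def)
    qed
    ultimately show ?case using m(2) by (intro exI[of _ m']) simp
  qed
  from this[of "s - sum l K"] obtain m where m: "\<And>i. i \<in> K \<Longrightarrow> l i \<le> m i \<and> m i \<le> l' i"
    "sum m K = s" "\<And>i j. i \<in> K \<Longrightarrow> j \<in> K \<Longrightarrow> l i < m i \<Longrightarrow> m j < l' j \<Longrightarrow> m i \<le> Suc (m j)"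
    using assms(3,4) by auto
  show ?thesis
  proof (rule that[OF m(1,2)])
    fix n
    show "(\<Sum>i\<in>K. min (m i) n) = (\<Sum>i\<in>K. min (l' i) n) \<or>
      (\<Sum>i\<in>K. min (m i) n) + sum l K = s + (\<Sum>i\<in>K. min (l i) n)"
    proof (cases "\<exists>j\<in>K. m j < l' j \<and> m j < n")
      case True
      then obtain j where j: "j \<in> K" "m j < l' j" "m j < n" by blast
      have "min (m i) n + l i = m i + min (l i) n" if "i \<in> K" for i
        using m(1)[OF that] m(3)[OF that j(1) _ j(2)] j(3) by (cases "l i < m i") auto
      then have "(\<Sum>i\<in>K. min (m i) n + l i) = (\<Sum>i\<in>K. m i + min (l i) n)" by simp
      then show ?thesis using m(2) by (simp add: sum.distrib)
    next
      case False
      have "min (m i) n = min (l' i) n" if "i \<in> K" for i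
        using m(1)[OF that] False that by (cases "m i < l' i") auto
      then show ?thesis by simp
    qed
  qed
qed

lemma sum_degrees:
  assumes "finite V" "finite K" "\<And>i. i \<in> K \<Longrightarrow> S i \<subseteq> V"
  shows "(\<Sum>v\<in>V. card {i \<in> K. v \<in> S i}) = (\<Sum>i\<in>K. card (S i))"
proof (rule sum_multicount_gen)
  have "{v \<in> V. v \<in> S i} = S i" if "i \<in> K" for i using assms(3)[OF that] by auto
  then show "\<forall>i\<in>K. card {v \<in> V. v \<in> S i} = card (S i)" by simp
qed (use assms in auto)

text \<open>A vertex \<open>v\<close> of degree above \<open>h\<close> can hand over one of its sets to a vertex \<open>w\<close> of degree below \<open>h\<close>. Only
  sets containing \<open>v\<close> but not \<open>w\<close> can suffer, and these are still met by the at least \<open>h\<close> root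
  sets that remain at \<open>v\<close>.\<close>

lemma bounded_degree_cover:
  assumes fin: "finite V" "finite K"
    and sub: "\<And>i. i \<in> K \<Longrightarrow> S i \<subseteq> V" and "(\<Sum>i\<in>K. card (S i)) \<le> h * card V"
    and bound: "\<And>X. X \<subseteq> V \<Longrightarrow> X \<noteq> {} \<Longrightarrow> p X \<le> int h"
    and cover: "\<And>X. X \<subseteq> V \<Longrightarrow> X \<noteq> {} \<Longrightarrow> p X \<le> int (card {i \<in> K. X \<inter> S i \<noteq> {}})"
  obtains T where "\<And>i. i \<in> K \<Longrightarrow> T i \<subseteq> V \<and> card (T i) = card (S i)"
    and "\<And>v. v \<in> V \<Longrightarrow> card {i \<in> K. v \<in> T i} \<le> h"
    and "\<And>X. X \<subseteq> V \<Longrightarrow> X \<noteq> {} \<Longrightarrow> p X \<le> int (card {i \<in> K. X \<inter> T i \<noteq> {}})"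
  using sub \<open>(\<Sum>i\<in>K. card (S i)) \<le> h * card V\<close> cover
proof (induction "\<Sum>v\<in>V. card {i \<in> K. v \<in> S i} - h" arbitrary: S thesis rule: less_induct)
  case less
  note sub = less.prems(2) and total = less.prems(3) and cover = less.prems(4)
  define deg where "deg S v = card {i \<in> K. v \<in> S i}" for S and v :: 'a
  show ?case
  proof (cases "\<exists>v\<in>V. h < deg S v")
    case False
    show ?thesis
      by (rule less.prems(1)[of S]) (use False sub cover in \<open>auto simp: deg_def not_less\<close>)
  next
    case True
    then obtain v where v: "v \<in> V" "h < deg S v" ..
    have "\<exists>w\<in>V. deg S w < h"
    proof (rule ccontr)
      assume "\<not> ?thesis"
      then have "\<forall>w\<in>V. h \<le> deg S w" by (simp add: not_less)
      then have "(\<Sum>w\<in>V. h) < (\<Sum>w\<in>V. deg S w)"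
        using v fin(1) by (intro sum_strict_mono_ex1) auto
      then show False using sum_degrees[OF fin sub] total by (simp add: deg_def mult.commute)
    qed
    then obtain w where w: "w \<in> V" "deg S w < h" ..
    have "\<not> {i \<in> K. v \<in> S i} \<subseteq> {i \<in> K. w \<in> S i}"
    proof
      assume "{i \<in> K. v \<in> S i} \<subseteq> {i \<in> K. w \<in> S i}"
      then have "deg S v \<le> deg S w" unfolding deg_def using fin(2) by (intro card_mono) auto
      then show False using v w by simp
    qed
    then obtain i where i: "i \<in> K" "v \<in> S i" "w \<notin> S i" by blast
    define T where "T = S(i := insert w (S i - {v}))"
    have Tsub: "T j \<subseteq> V" if "j \<in> K" for j using sub[OF that] w(1) by (auto simp: T_def)
    have "finite (S i)" using finite_subset[OF sub[OF i(1)] fin(1)] .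
    then have "card (insert w (S i - {v})) = card (S i)"
      using i(2,3) card_Suc_Diff1[of "S i" v] by simp
    then have Tcard: "card (T j) = card (S j)" for j by (simp add: T_def)
    have degv: "deg S v = Suc (deg T v)"
    proof -
      have "{j \<in> K. v \<in> S j} = insert i {j \<in> K. v \<in> T j}" "i \<notin> {j \<in> K. v \<in> T j}"
        using i by (auto simp: T_def)
      then show ?thesis unfolding deg_def using fin(2) by simp
    qed
    have degw: "deg T w = Suc (deg S w)"
    proof -
      have "{j \<in> K. w \<in> T j} = insert i {j \<in> K. w \<in> S j}" "i \<notin> {j \<in> K. w \<in> S j}"
        using i by (auto simp: T_def)
      then show ?thesis unfolding deg_def using fin(2) by simp
    qed
    have dego: "deg T u = deg S u" if "u \<noteq> v" "u \<noteq> w" for u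
      unfolding deg_def using that by (intro arg_cong[where f = card]) (auto simp: T_def)
    have "(\<Sum>u\<in>V. deg T u - h) < (\<Sum>u\<in>V. deg S u - h)"
    proof (rule sum_strict_mono_ex1)
      have "deg T u - h \<le> deg S u - h" for u
        using degv degw dego[of u] w(2) by (cases "u = v"; cases "u = w") auto
      then show "\<forall>u\<in>V. deg T u - h \<le> deg S u - h" by simp
      show "\<exists>u\<in>V. deg T u - h < deg S u - h" using v degv by (intro bexI[of _ v]) auto
    qed (rule fin)
    then have dec: "(\<Sum>u\<in>V. card {j \<in> K. u \<in> T j} - h) < (\<Sum>u\<in>V. card {j \<in> K. u \<in> S j} - h)"
      unfolding deg_def .
    have Tcover: "p X \<le> int (card {j \<in> K. X \<inter> T j \<noteq> {}})" if X: "X \<subseteq> V" "X \<noteq> {}" for X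
    proof (cases "v \<in> X \<and> w \<notin> X")
      case True
      then have "{j \<in> K. v \<in> T j} \<subseteq> {j \<in> K. X \<inter> T j \<noteq> {}}" by auto
      then have "deg T v \<le> card {j \<in> K. X \<inter> T j \<noteq> {}}"
        unfolding deg_def using fin(2) by (intro card_mono) auto
      then show ?thesis using bound[OF X] degv v(2) by linarith
    next
      case False
      then have "{j \<in> K. X \<inter> S j \<noteq> {}} \<subseteq> {j \<in> K. X \<inter> T j \<noteq> {}}" by (auto simp: T_def)
      then have "card {j \<in> K. X \<inter> S j \<noteq> {}} \<le> card {j \<in> K. X \<inter> T j \<noteq> {}}"
        using fin(2) by (intro card_mono) auto
      then show ?thesis using cover[OF X] by linarith
    qed
    show ?thesis
    proof (rule less.hyps[OF dec])
      fix T' assume T': "\<And>j. j \<in> K \<Longrightarrow> T' j \<subseteq> V \<and> card (T' j) = card (T j)"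
        "\<And>u. u \<in> V \<Longrightarrow> card {j \<in> K. u \<in> T' j} \<le> h"
        "\<And>X. X \<subseteq> V \<Longrightarrow> X \<noteq> {} \<Longrightarrow> p X \<le> int (card {j \<in> K. X \<inter> T' j \<noteq> {}})"
      show thesis by (rule less.prems(1)[of T']) (use T' Tcard in auto)
    qed (use Tsub Tcard total Tcover in auto)
  qed
qed

section \<open>Growing the branchings by one hyperarc\<close>

definition entering :: "('v, 'e) dypergraph \<Rightarrow> 'e set \<Rightarrow> 'v set \<Rightarrow> nat" where
  "entering D A X = card {e \<in> A. enters D e X}"

lemma entering_submodular:
  assumes "finite A"
  shows "entering D A (X \<union> Y) + entering D A (X \<inter> Y) \<le> entering D A X + entering D A Y"
proof -
  define E where "E X = {e \<in> A. enters D e X}" for X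
  have fin: "finite (E X)" for X using assms by (simp add: E_def)
  have "card (E (X \<union> Y)) + card (E (X \<inter> Y)) =
      card (E (X \<union> Y) \<union> E (X \<inter> Y)) + card (E (X \<union> Y) \<inter> E (X \<inter> Y))"
    using card_Un_Int fin by blast
  also have "\<dots> \<le> card (E X \<union> E Y) + card (E X \<inter> E Y)"
    by (intro add_mono card_mono) (use fin in \<open>auto simp: E_def enters_def\<close>)
  also have "\<dots> = card (E X) + card (E Y)" using card_Un_Int[OF fin fin] by simp
  finally show ?thesis by (simp add: entering_def E_def)
qed

lemma entering_hverts:
  assumes "dypergraph D" "A \<subseteq> hyperarcs D"
  shows "entering D A (hverts D) = 0"
  using assms dypergraph.htails_in_hverts[OF assms(1)]
  by (auto simp: entering_def enters_def card_eq_0_iff)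

lemma entering_count_eq_sum:
  assumes "dypergraph D" "subpartition (hverts D) P"
  shows "entering_count D P = (\<Sum>X\<in>P. entering D (hyperarcs D) X)"
proof -
  have finP: "finite P" using subpartition_finite[OF dypergraph.finite_hverts] assms by blast
  have "{e \<in> hyperarcs D. \<exists>X\<in>P. enters D e X} = (\<Union>X\<in>P. {e \<in> hyperarcs D. enters D e X})" by auto
  moreover have "card \<dots> = (\<Sum>X\<in>P. card {e \<in> hyperarcs D. enters D e X})"
    using finP dypergraph.finite_hyperarcs[OF assms(1)] subpartition_disjoint[OF assms(2)]
    by (intro card_UN_disjoint) (auto simp: enters_def)
  ultimately show ?thesis by (simp add: entering_count_def entering_def)
qed

text \<open>\<open>A\<close> is the set of unused hyperarcs and \<open>U i\<close> the core built so far. A hyperarc \<open>e\<close> is passed to the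
  branching \<open>i\<close>; this violates the covering condition only at a tight set that is entered by \<open>e\<close> and
  already met by \<open>U i\<close>.

  Take an inclusion-minimal set \<open>X\<close> that is tight, or all of \<open>V\<close>, and contains a vertex of degree below \<open>h\<close>
  that does not belong to all cores meeting \<open>X\<close>. Let \<open>v\<close> have least degree in \<open>X\<close> and let
  \<open>Z\<close> consist of the vertices of \<open>X\<close> in the same cores as \<open>v\<close>. Fewer cores meet \<open>Z\<close> than \<open>X\<close>, and
  fewer than \<open>h\<close>, so more hyperarcs enter \<open>Z\<close> than \<open>X\<close>, and some \<open>e\<close> enters \<open>Z\<close> with all its tails in \<open>X\<close>. A tail outside
  \<open>Z\<close> lies in some core that does not contain \<open>v\<close>, as the degree of \<open>v\<close> is least; this is \<open>i\<close>.
  A tight set \<open>Y\<close> that forbids this choice would itself be one of the sets among which \<open>X\<close> is minimal.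
  So \<open>X\<close> is not \<open>V\<close> but tight, and uncrossing shows that \<open>X \<inter> Y\<close>, a proper subset of \<open>X\<close>, is another
  such set.\<close>

lemma growth_step:
  assumes D: "dypergraph D" and A: "A \<subseteq> hyperarcs D" and finK: "finite K"
    and U: "\<And>i. i \<in> K \<Longrightarrow> U i \<subseteq> hverts D"
    and cover: "\<And>X. X \<subseteq> hverts D \<Longrightarrow> X \<noteq> {} \<Longrightarrow>
        h \<le> entering D A X + card {i \<in> K. X \<inter> U i \<noteq> {}}"
    and v\<^sub>0: "v\<^sub>0 \<in> hverts D" "card {i \<in> K. v\<^sub>0 \<in> U i} < h"
  obtains e i where "e \<in> A" "i \<in> K" "hhead D e \<notin> U i" "htails D e \<inter> U i \<noteq> {}"
    and "card {j \<in> K. hhead D e \<in> U j} < h"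
    and "\<And>X. X \<subseteq> hverts D \<Longrightarrow> X \<noteq> {} \<Longrightarrow>
        h \<le> entering D (A - {e}) X + card {j \<in> K. X \<inter> (U(i := insert (hhead D e) (U i))) j \<noteq> {}}"
proof -
  define V where "V = hverts D"
  have finV: "finite V" and finA: "finite A"
    using D A finite_subset by (auto simp: V_def dypergraph_def)
  \<comment> \<open>\<open>C w\<close> and \<open>M X\<close> are the indices of the cores containing \<open>w\<close> and of those meeting \<open>X\<close>.\<close>
  define C where "C v = {i \<in> K. v \<in> U i}" for v
  define M where "M X = {i \<in> K. X \<inter> U i \<noteq> {}}" for X
  have finM: "finite (M X)" for X using finK by (simp add: M_def)
  have CM: "C v \<subseteq> M X" if "v \<in> X" for v X using that by (auto simp: C_def M_def)
  have finC: "finite (C v)" for v using finK by (simp add: C_def)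
  have M_Un: "M (X \<union> Y) = M X \<union> M Y" and M_Int: "M (X \<inter> Y) \<subseteq> M X \<inter> M Y" for X Y
    by (auto simp: M_def)
  have cover': "h \<le> entering D A X + card (M X)" if "X \<subseteq> V" "X \<noteq> {}" for X
    using cover that by (simp add: V_def M_def)
  define tight where "tight X \<longleftrightarrow> entering D A X + card (M X) = h" for X
  define \<X> where "\<X> = {X. X \<subseteq> V \<and> (X = V \<or> tight X) \<and> (\<exists>v\<in>X. C v \<noteq> M X \<and> card (C v) < h)}"
  have enV: "entering D A V = 0" unfolding V_def by (rule entering_hverts[OF D A])
  have "h \<le> card (M V)" using cover'[of V] v\<^sub>0(1) enV by (auto simp: V_def)
  then have "card (C v\<^sub>0) < card (M V)" using v\<^sub>0(2) by (simp add: C_def)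
  then have "C v\<^sub>0 \<noteq> M V" by auto
  then have "V \<in> \<X>" using v\<^sub>0 unfolding \<X>_def C_def V_def by blast
  moreover have "finite \<X>" by (rule finite_subset[of _ "Pow V"]) (use finV in \<open>auto simp: \<X>_def\<close>)
  ultimately obtain X where X: "X \<in> \<X>" "\<And>Y. Y \<in> \<X> \<Longrightarrow> Y \<subseteq> X \<Longrightarrow> X = Y"
    using finite_has_minimal[of \<X>] by auto
  have XV: "X \<subseteq> V" and XT: "X = V \<or> tight X" using X(1) by (auto simp: \<X>_def)
  obtain x where x: "x \<in> X" "C x \<noteq> M X" "card (C x) < h" using X(1) by (auto simp: \<X>_def)
  have finX: "finite X" using finite_subset[OF XV finV] .
  obtain v where v: "v \<in> X" "\<And>w. w \<in> X \<Longrightarrow> card (C v) \<le> card (C w)"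
    using arg_min_if_finite(1)[OF finX, of "\<lambda>w. card (C w)"]
      arg_min_least[OF finX, of _ "\<lambda>w. card (C w)"] x(1) by (metis empty_iff)
  have "card (C v) \<le> card (C x)" using v(2) x(1) by blast
  also have "\<dots> < card (M X)" using x(2) CM[OF x(1)] finM by (intro psubset_card_mono) auto
  finally have vM: "card (C v) < card (M X)" .
  have vh: "card (C v) < h" using v(2)[OF x(1)] x(3) by simp
  define Z where "Z = {w \<in> X. C w = C v}"
  have ZV: "Z \<subseteq> V" "Z \<noteq> {}" using XV v(1) by (auto simp: Z_def)
  have "M Z = C v" using v(1) unfolding M_def Z_def C_def by blast
  then have "h \<le> entering D A Z + card (C v)" using cover'[OF ZV] by simp
  then have "entering D A X < entering D A Z"
    using XT enV vM vh by (auto simp: tight_def)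
  have "\<not> {e \<in> A. enters D e Z} \<subseteq> {e \<in> A. enters D e X}"
  proof
    assume "{e \<in> A. enters D e Z} \<subseteq> {e \<in> A. enters D e X}"
    then have "entering D A Z \<le> entering D A X"
      unfolding entering_def using finA by (intro card_mono) auto
    then show False using \<open>entering D A X < entering D A Z\<close> by simp
  qed
  then obtain e where e: "e \<in> A" "enters D e Z" "\<not> enters D e X" by blast
  define y where "y = hhead D e"
  have y: "y \<in> X" "C y = C v" using e(2) by (auto simp: enters_def Z_def y_def)
  have tails: "htails D e \<subseteq> X" using e(3) y(1) by (auto simp: enters_def y_def)
  obtain u where u: "u \<in> htails D e" "u \<in> X" "C u \<noteq> C v"
    using e(2) tails by (auto simp: enters_def Z_def)
  have "\<not> C u \<subseteq> C v" using card_seteq[OF finC] v(2)[OF u(2)] u(3) by blast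
  then obtain i where i: "i \<in> K" "u \<in> U i" "i \<notin> C v" by (auto simp: C_def)
  have yU: "y \<notin> U i" using i y(2) by (auto simp: C_def)
  define U' where "U' = U(i := insert y (U i))"
  show ?thesis
  proof (rule that[OF e(1) i(1)])
    show "hhead D e \<notin> U i" using yU by (simp add: y_def)
    show "htails D e \<inter> U i \<noteq> {}" using u i by blast
    show "card {j \<in> K. hhead D e \<in> U j} < h" using vh y(2) by (simp add: C_def y_def)
    fix Y assume Y: "Y \<subseteq> hverts D" "Y \<noteq> {}"
    have YV: "Y \<subseteq> V" using Y by (simp add: V_def)
    have MU: "M Y \<subseteq> {j \<in> K. Y \<inter> U' j \<noteq> {}}" by (auto simp: M_def U'_def)
    then have MU_le: "card (M Y) \<le> card {j \<in> K. Y \<inter> U' j \<noteq> {}}" using finK by (intro card_mono) auto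
    have "h \<le> entering D (A - {e}) Y + card {j \<in> K. Y \<inter> U' j \<noteq> {}}"
    proof (cases "enters D e Y")
      case False
      then have "entering D (A - {e}) Y = entering D A Y"
        unfolding entering_def by (intro arg_cong[where f = card]) auto
      then show ?thesis using cover'[OF YV Y(2)] MU_le by simp
    next
      case True
      have yY: "y \<in> Y" using True by (simp add: enters_def y_def)
      have "{a \<in> A. enters D a Y} = insert e {a \<in> A - {e}. enters D a Y}" using True e(1) by auto
      then have en: "entering D A Y = Suc (entering D (A - {e}) Y)"
        unfolding entering_def using finA by simp
      show ?thesis
      proof (cases "i \<in> M Y")
        case False
        moreover have "i \<in> {j \<in> K. Y \<inter> U' j \<noteq> {}}" using yY i(1) by (auto simp: U'_def)
        ultimately have "M Y \<subset> {j \<in> K. Y \<inter> U' j \<noteq> {}}" using MU by blast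
        then have "card (M Y) < card {j \<in> K. Y \<inter> U' j \<noteq> {}}" using finK by (intro psubset_card_mono) auto
        then show ?thesis using cover'[OF YV Y(2)] en by simp
      next
        case True
        have "\<not> tight Y"
        proof
          assume tY: "tight Y"
          have "C y \<noteq> M Y" "card (C y) < h" using True i(3) y(2) vh by auto
          then have "Y \<in> \<X>" using tY YV yY unfolding \<X>_def by blast
          then have "\<not> Y \<subseteq> X" using X(2) \<open>enters D e Y\<close> e(3) by blast
          then have "X \<noteq> V" using YV by blast
          then have tX: "tight X" using XT by simp
          have "X \<inter> Y \<noteq> {}" "X \<union> Y \<noteq> {}" using y(1) yY by auto
          then have ge: "h \<le> entering D A (X \<inter> Y) + card (M (X \<inter> Y))"
            "h \<le> entering D A (X \<union> Y) + card (M (X \<union> Y))"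
            using cover'[of "X \<inter> Y"] cover'[of "X \<union> Y"] XV YV by auto
          \<comment> \<open>All three submodular inequalities hold with equality, so a core meeting both \<open>X\<close> and \<open>Y\<close>
            has to meet \<open>X \<inter> Y\<close>.\<close>
          have cards: "card (M X) + card (M Y) = card (M (X \<union> Y)) + card (M X \<inter> M Y)"
            unfolding M_Un using card_Un_Int[OF finM finM] .
          have Mle: "card (M (X \<inter> Y)) \<le> card (M X \<inter> M Y)"
            using finM M_Int by (intro card_mono) auto
          have eq: "tight (X \<inter> Y)" "card (M (X \<inter> Y)) = card (M X \<inter> M Y)"
            using tX tY ge cards Mle entering_submodular[OF finA, of D X Y]
            unfolding tight_def by linarith+
          then have "M (X \<inter> Y) = M X \<inter> M Y" using card_seteq[OF _ M_Int] finM by (metis finite_Int order_refl)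
          moreover have "i \<in> M X" using i u by (auto simp: M_def)
          ultimately have "i \<in> M (X \<inter> Y)" using True by simp
          then have "C y \<noteq> M (X \<inter> Y)" "card (C y) < h" using i(3) y(2) vh by auto
          then have "X \<inter> Y \<in> \<X>" using eq(1) XV y(1) yY unfolding \<X>_def by blast
          then have "X \<subseteq> Y" using X(2) by blast
          then show False using tails \<open>enters D e Y\<close> by (auto simp: enters_def)
        qed
        then show ?thesis using cover'[OF YV Y(2)] MU_le en by (simp add: tight_def)
      qed
    qed
    then show "h \<le> entering D (A - {e}) Y + card {j \<in> K. Y \<inter> (U(i := insert (hhead D e) (U i))) j \<noteq> {}}"
      by (simp add: U'_def y_def)
  qed
qed

section \<open>Hyperbranchings\<close>

lemma subdypergraph_hyperarcs:
  fixes D :: "('v, 'e) dypergraph"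
  assumes "dypergraph D" "F \<subseteq> hyperarcs D"
  shows "subdypergraph (D\<lparr>hyperarcs := F\<rparr>) D"
  using assms finite_subset[OF assms(2)]
  by (auto simp: subdypergraph_def dypergraph_def subset_iff)

lemma hyperbranching_roots:
  fixes D :: "('v, 'e) dypergraph"
  assumes "dypergraph D" "S \<subseteq> hverts D" "S \<noteq> {}"
  shows "hyperbranching (D\<lparr>hyperarcs := {}\<rparr>) S"
proof -
  have "finite S" using assms finite_subset by (auto simp: dypergraph_def)
  define G where "G = trimmed (D\<lparr>hyperarcs := {}\<rparr>) S undefined"
  have G: "verts G = S" "arcs G = {}"
    by (simp_all add: G_def trimmed_def core_def)
  interpret fin_digraph G
    by unfold_locales (use G \<open>finite S\<close> in auto)
  have "v \<rightarrow>\<^sup>*\<^bsub>G\<^esub> v" if "v \<in> S" for v using that reachable_refl by (simp add: G)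
  then have "branching G S"
    unfolding branching_iff_in_degree
    using assms(3) fin_digraph_axioms unfolding G in_degree_def in_arcs_def by auto
  then show ?thesis
    using assms subdypergraph_hyperarcs[OF assms(1), of "{}"]
    by (auto simp: hyperbranching_def subdypergraph_def G_def)
qed

text \<open>The new hyperarc is trimmed at a tail in the old core, so its head becomes a new leaf.\<close>

lemma hyperbranching_insert:
  fixes D :: "('v, 'e) dypergraph"
  assumes D: "dypergraph D" and F: "F \<subseteq> hyperarcs D" and e: "e \<in> hyperarcs D"
    and hb: "hyperbranching (D\<lparr>hyperarcs := F\<rparr>) S"
    and tail: "htails D e \<inter> core (D\<lparr>hyperarcs := F\<rparr>) S \<noteq> {}"
    and head: "hhead D e \<notin> core (D\<lparr>hyperarcs := F\<rparr>) S"
  shows "hyperbranching (D\<lparr>hyperarcs := insert e F\<rparr>) S"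
proof -
  define W where "W = hhead D ` F \<union> S"
  have core: "core (D\<lparr>hyperarcs := F\<rparr>) S = W"
    "core (D\<lparr>hyperarcs := insert e F\<rparr>) S = insert (hhead D e) W"
    by (auto simp: core_def W_def)
  obtain t where t: "\<forall>f\<in>F. t f \<in> htails D f" "branching (trimmed (D\<lparr>hyperarcs := F\<rparr>) S t) S"
    using hb by (auto simp: hyperbranching_def)
  obtain u where u: "u \<in> htails D e" "u \<in> W" using tail by (auto simp: core)
  have eF: "e \<notin> F" using head by (auto simp: core_def)
  define G where "G = trimmed (D\<lparr>hyperarcs := F\<rparr>) S t"
  define H where "H = trimmed (D\<lparr>hyperarcs := insert e F\<rparr>) S (t(e := u))"
  have G: "verts G = W" "arcs G = F" "tail G = t" "head G = hhead D"
    by (simp_all add: G_def trimmed_def core)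
  have H: "verts H = insert (hhead D e) W" "arcs H = insert e F" "tail H = t(e := u)"
    "head H = hhead D"
    by (simp_all add: H_def trimmed_def core)
  have br: "fin_digraph G" "W \<noteq> {}" "S \<subseteq> W"
    "\<And>v. v \<in> W \<Longrightarrow> in_degree G v = (if v \<in> S then 0 else 1)"
    "\<And>v. v \<in> W \<Longrightarrow> \<exists>s\<in>S. s \<rightarrow>\<^sup>*\<^bsub>G\<^esub> v"
    using t(2) unfolding branching_iff_in_degree G_def[symmetric] G by auto
  interpret G: fin_digraph G by (rule br(1))
  have tW: "t f \<in> W" if "f \<in> F" for f
    using G.tail_in_verts[of f] that by (simp add: G)
  have "finite F" "finite W" using G.finite_arcs G.finite_verts by (simp_all add: G)
  then interpret H: fin_digraph H
    by unfold_locales (use u(2) tW in \<open>auto simp: H W_def\<close>)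
  have "arcs_ends G \<subseteq> arcs_ends H"
    using eF by (auto simp: arcs_ends_def arc_to_ends_def G H image_iff)
  then have mono: "s \<rightarrow>\<^sup>*\<^bsub>H\<^esub> v" if "s \<rightarrow>\<^sup>*\<^bsub>G\<^esub> v" for s v
    using that rtrancl_on_mono[of "arcs_ends G" "arcs_ends H" "verts G" "verts H" s v]
    unfolding reachable_def by (auto simp: G H)
  have "in_degree H v = (if v \<in> S then 0 else 1) \<and> (\<exists>s\<in>S. s \<rightarrow>\<^sup>*\<^bsub>H\<^esub> v)" if "v \<in> verts H" for v
  proof (cases "v = hhead D e")
    case True
    have "hhead D f \<noteq> hhead D e" if "f \<in> F" for f
      using head imageI[OF that, of "hhead D"] unfolding core W_def by auto
    then have "in_arcs H v = {e}" using True by (auto simp: in_arcs_def H)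
    moreover have "v \<notin> S" using True head br(3) by (auto simp: core)
    moreover obtain s where "s \<in> S" "s \<rightarrow>\<^sup>*\<^bsub>H\<^esub> u" using br(5)[OF u(2)] mono by blast
    moreover have "u \<rightarrow>\<^bsub>H\<^esub> v"
      using H.in_arcs_imp_in_arcs_ends[of e] True by (simp add: H)
    ultimately show ?thesis using H.reachable_adj_trans[of _ u v] unfolding in_degree_def by auto
  next
    case False
    then have v: "v \<in> W" using that by (simp add: H)
    have "in_arcs H v = in_arcs G v" using False by (auto simp: in_arcs_def H G)
    then show ?thesis using br(4)[OF v] br(5)[OF v] mono by (auto simp: in_degree_def)
  qed
  then have "branching H S"
    unfolding branching_iff_in_degree using H.fin_digraph_axioms br(3) by (auto simp: H)
  moreover have "\<forall>f\<in>insert e F. (t(e := u)) f \<in> htails D f" using t(1) u(1) by simp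
  moreover have "dypergraph (D\<lparr>hyperarcs := insert e F\<rparr>)"
    using subdypergraph_hyperarcs[OF D, of "insert e F"] e F by (simp add: subdypergraph_def)
  moreover have "S \<subseteq> hverts D" using hb by (simp add: hyperbranching_def)
  ultimately show ?thesis
    unfolding hyperbranching_def H_def by (intro conjI exI[of _ "t(e := u)"]) simp_all
qed

text \<open>On the path from a root to \<open>v\<close>, some arc enters \<open>X\<close>; the hyperarc it was trimmed from
  enters \<open>X\<close> as well.\<close>

lemma hyperbranching_entered:
  assumes hb: "hyperbranching B S" and v: "v \<in> core B S" "v \<in> X" and "X \<inter> S = {}"
  obtains e where "e \<in> hyperarcs B" "enters B e X"
proof -
  obtain t where t: "\<forall>e\<in>hyperarcs B. t e \<in> htails B e" "branching (trimmed B S t) S"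
    using hb by (auto simp: hyperbranching_def)
  define G where "G = trimmed B S t"
  have br: "fin_digraph G" "\<And>v. v \<in> verts G \<Longrightarrow> \<exists>s\<in>S. s \<rightarrow>\<^sup>*\<^bsub>G\<^esub> v"
    using t(2) unfolding branching_iff_in_degree G_def[symmetric] by auto
  interpret fin_digraph G by (rule br(1))
  obtain s where s: "s \<in> S" "s \<rightarrow>\<^sup>*\<^bsub>G\<^esub> v" using br(2)[of v] v(1) by (auto simp: G_def trimmed_def)
  from s(2) have "v \<in> X \<longrightarrow> (\<exists>e\<in>hyperarcs B. enters B e X)"
  proof (induction rule: reachable_induct)
    case base
    then show ?case using s(1) \<open>X \<inter> S = {}\<close> by blast
  next
    case (step x y)
    then obtain e where "e \<in> hyperarcs B" "t e = x" "hhead B e = y"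
      by (auto simp: arcs_ends_def arc_to_ends_def G_def trimmed_def)
    then show ?case using step t(1) by (auto simp: enters_def)
  qed
  then show ?thesis using v(2) that by blast
qed

section \<open>Packings of hyperbranchings\<close>

lemma packing_growth:
  fixes D :: "('v, 'e) dypergraph" and F :: "nat \<Rightarrow> 'e set"
  defines "U \<equiv> \<lambda>S F i. core (D\<lparr>hyperarcs := F i\<rparr>) (S i)"
  assumes D: "dypergraph D" and finK: "finite K"
    and F: "\<And>i. i \<in> K \<Longrightarrow> F i \<subseteq> hyperarcs D \<and> hyperbranching (D\<lparr>hyperarcs := F i\<rparr>) (S i)"
    and disj: "disjoint_family_on F K"
    and bound: "\<And>v. v \<in> hverts D \<Longrightarrow> card {i \<in> K. v \<in> U S F i} \<le> h"
    and cover: "\<And>X. X \<subseteq> hverts D \<Longrightarrow> X \<noteq> {} \<Longrightarrow>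
        h \<le> entering D (hyperarcs D - \<Union>(F ` K)) X + card {i \<in> K. X \<inter> U S F i \<noteq> {}}"
  obtains F' where
    "\<And>i. i \<in> K \<Longrightarrow> F' i \<subseteq> hyperarcs D \<and> hyperbranching (D\<lparr>hyperarcs := F' i\<rparr>) (S i)"
    and "disjoint_family_on F' K" and "\<And>v. v \<in> hverts D \<Longrightarrow> card {i \<in> K. v \<in> U S F' i} = h"
  using F disj bound cover
proof (induction "\<Sum>v\<in>hverts D. h - card {i \<in> K. v \<in> U S F i}" arbitrary: F thesis rule: less_induct)
  case less
  note F = less.prems(2) and disj = less.prems(3) and bound = less.prems(4) and cover = less.prems(5)
  have finV: "finite (hverts D)" using D by (simp add: dypergraph_def)
  show ?case
  proof (cases "\<exists>v\<in>hverts D. card {i \<in> K. v \<in> U S F i} < h")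
    case False
    show ?thesis
      by (rule less.prems(1)[of F]) (use False F disj bound in \<open>auto simp: not_less intro: le_antisym\<close>)
  next
    case True
    then obtain v\<^sub>0 where v\<^sub>0: "v\<^sub>0 \<in> hverts D" "card {i \<in> K. v\<^sub>0 \<in> U S F i} < h" ..
    define A where "A = hyperarcs D - \<Union>(F ` K)"
    have UV: "U S F i \<subseteq> hverts D" if "i \<in> K" for i
      using F[OF that] dypergraph.hhead_in_hverts[OF D]
      by (auto simp: U_def core_def hyperbranching_def)
    obtain e i where ei: "e \<in> A" "i \<in> K" "hhead D e \<notin> U S F i" "htails D e \<inter> U S F i \<noteq> {}"
      "card {j \<in> K. hhead D e \<in> U S F j} < h"
      and cover': "\<And>X. X \<subseteq> hverts D \<Longrightarrow> X \<noteq> {} \<Longrightarrow> h \<le> entering D (A - {e}) X +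
          card {j \<in> K. X \<inter> ((U S F)(i := insert (hhead D e) (U S F i))) j \<noteq> {}}"
    proof (rule growth_step[OF D _ finK UV _ v\<^sub>0])
      show "A \<subseteq> hyperarcs D" by (auto simp: A_def)
    qed (use cover in \<open>auto simp: A_def\<close>)
    define F\<^sub>1 where "F\<^sub>1 = F(i := insert e (F i))"
    define y where "y = hhead D e"
    have e: "e \<in> hyperarcs D" and eF: "\<And>j. j \<in> K \<Longrightarrow> e \<notin> F j" using ei(1) by (auto simp: A_def)
    have yV: "y \<in> hverts D" using dypergraph.hhead_in_hverts[OF D e] by (simp add: y_def)
    have U\<^sub>1: "U S F\<^sub>1 = (U S F)(i := insert y (U S F i))"
      by (rule ext) (simp add: U_def F\<^sub>1_def core_def y_def)
    have A\<^sub>1: "hyperarcs D - \<Union>(F\<^sub>1 ` K) = A - {e}"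
      using ei(2) by (auto simp: A_def F\<^sub>1_def split: if_splits)
    have F1: "F\<^sub>1 j \<subseteq> hyperarcs D \<and> hyperbranching (D\<lparr>hyperarcs := F\<^sub>1 j\<rparr>) (S j)" if j: "j \<in> K" for j
    proof (cases "j = i")
      case True
      have "hyperbranching (D\<lparr>hyperarcs := insert e (F i)\<rparr>) (S i)"
        by (rule hyperbranching_insert[OF D _ e]) (use F ei in \<open>auto simp: U_def\<close>)
      then show ?thesis using F[OF j] e True by (simp add: F\<^sub>1_def)
    next
      case False
      then show ?thesis using F[OF j] by (simp add: F\<^sub>1_def)
    qed
    have disj1: "disjoint_family_on F\<^sub>1 K"
      using disj eF unfolding disjoint_family_on_def F\<^sub>1_def by auto
    have degy: "card {j \<in> K. y \<in> U S F\<^sub>1 j} = Suc (card {j \<in> K. y \<in> U S F j})"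
    proof -
      have "{j \<in> K. y \<in> U S F\<^sub>1 j} = insert i {j \<in> K. y \<in> U S F j}"
        using ei(2) by (auto simp: U\<^sub>1)
      then show ?thesis using finK ei(3) by (simp add: y_def)
    qed
    have dego: "{j \<in> K. v \<in> U S F\<^sub>1 j} = {j \<in> K. v \<in> U S F j}" if "v \<noteq> y" for v
      using that by (auto simp: U\<^sub>1)
    have dec: "(\<Sum>v\<in>hverts D. h - card {j \<in> K. v \<in> U S F\<^sub>1 j})
        < (\<Sum>v\<in>hverts D. h - card {j \<in> K. v \<in> U S F j})"
    proof (rule sum_strict_mono_ex1[OF finV])
      have "h - card {j \<in> K. v \<in> U S F\<^sub>1 j} \<le> h - card {j \<in> K. v \<in> U S F j}" for v
        using degy dego[of v] by (cases "v = y") auto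
      then show "\<forall>v\<in>hverts D. h - card {j \<in> K. v \<in> U S F\<^sub>1 j} \<le> h - card {j \<in> K. v \<in> U S F j}" by blast
      show "\<exists>v\<in>hverts D. h - card {j \<in> K. v \<in> U S F\<^sub>1 j} < h - card {j \<in> K. v \<in> U S F j}"
        using yV degy ei(5) by (intro bexI[of _ y]) (auto simp: y_def)
    qed
    show ?thesis
    proof (rule less.hyps[OF dec])
      show "card {j \<in> K. v \<in> U S F\<^sub>1 j} \<le> h" if "v \<in> hverts D" for v
        using bound[OF that] degy dego[of v] ei(5) by (cases "v = y") (auto simp: y_def)
      show "h \<le> entering D (hyperarcs D - \<Union>(F\<^sub>1 ` K)) X + card {j \<in> K. X \<inter> U S F\<^sub>1 j \<noteq> {}}"
        if "X \<subseteq> hverts D" "X \<noteq> {}" for X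
        using cover'[OF that] unfolding A\<^sub>1 U\<^sub>1 y_def .
    qed (use F1 disj1 less.prems(1) in blast)+
  qed
qed

text \<open>A version of Edmonds' disjoint branchings theorem in which the cores need not be spanning: the
  branchings are grown from their roots until every vertex lies in exactly \<open>h\<close> cores.\<close>

lemma packing_with_given_roots:
  fixes D :: "('v, 'e) dypergraph"
  assumes D: "dypergraph D"
    and S: "\<And>i. i \<in> {1..k} \<Longrightarrow> S i \<subseteq> hverts D \<and> S i \<noteq> {}"
    and bound: "\<And>v. v \<in> hverts D \<Longrightarrow> card {i \<in> {1..k}. v \<in> S i} \<le> h"
    and cover: "\<And>X. X \<subseteq> hverts D \<Longrightarrow> X \<noteq> {} \<Longrightarrow>
        h \<le> entering D (hyperarcs D) X + card {i \<in> {1..k}. X \<inter> S i \<noteq> {}}"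
  obtains B where "hyperbranching_packing D k B S" "regular_packing D h k B S"
proof -
  have core: "core (D\<lparr>hyperarcs := {}\<rparr>) (S i) = S i" for i by (simp add: core_def)
  obtain F where F: "\<And>i. i \<in> {1..k} \<Longrightarrow>
        F i \<subseteq> hyperarcs D \<and> hyperbranching (D\<lparr>hyperarcs := F i\<rparr>) (S i)"
    "disjoint_family_on F {1..k}"
    "\<And>v. v \<in> hverts D \<Longrightarrow> card {i \<in> {1..k}. v \<in> core (D\<lparr>hyperarcs := F i\<rparr>) (S i)} = h"
  proof (rule packing_growth[OF D, where F = "\<lambda>_. {}" and K = "{1..k}" and S = S and h = h])
    fix i assume "i \<in> {1..k}"
    then show "{} \<subseteq> hyperarcs D \<and> hyperbranching (D\<lparr>hyperarcs := {}\<rparr>) (S i)"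
      using S hyperbranching_roots[OF D] by auto
  next
    fix X assume "X \<subseteq> hverts D" "X \<noteq> {}"
    then show "h \<le> entering D (hyperarcs D - \<Union>((\<lambda>_. {}) ` {1..k})) X +
        card {i \<in> {1..k}. X \<inter> core (D\<lparr>hyperarcs := {}\<rparr>) (S i) \<noteq> {}}"
      using cover unfolding core by simp
  qed (use bound in \<open>auto simp: core disjoint_family_on_def\<close>)
  define B where "B i = D\<lparr>hyperarcs := F i\<rparr>" for i
  have "hyperbranching_packing D k B S"
    using F(1,2) subdypergraph_hyperarcs[OF D]
    by (simp add: hyperbranching_packing_def B_def disjoint_family_on_def)
  moreover have "regular_packing D h k B S"
    using F(3) by (simp add: regular_packing_def B_def)
  ultimately show ?thesis using that by blast
qed

lemma hits_le_card:
  assumes "subpartition V P" "finite S"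
  shows "hits S P \<le> card S"
proof -
  have "\<forall>X\<in>{X \<in> P. X \<inter> S \<noteq> {}}. \<exists>v. v \<in> X \<inter> S" by blast
  then obtain r where r: "\<forall>X\<in>{X \<in> P. X \<inter> S \<noteq> {}}. r X \<in> X \<inter> S" by metis
  have "inj_on r {X \<in> P. X \<inter> S \<noteq> {}}"
    by (rule inj_onI) (metis (mono_tags, lifting) IntE mem_Collect_eq r subpartition_disjoint[OF assms(1)])
  then show ?thesis
    unfolding hits_def by (rule card_inj_on_le) (use r assms(2) in auto)
qed

lemma card_subpartition_le:
  assumes "finite V" "subpartition V P"
  shows "card P \<le> card V"
proof -
  have "{X \<in> P. X \<inter> V \<noteq> {}} = P"
    using assms(2) by (auto simp: subpartition_def) (metis Int_absorb2 Sup_le_iff)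
  then show ?thesis using hits_le_card[OF assms(2,1)] by (simp add: hits_def)
qed

text \<open>Fix a member \<open>X\<close> and a vertex in it. Each of the \<open>h\<close> cores containing the vertex either has a root in \<open>X\<close> or
  uses a hyperarc of its own that enters \<open>X\<close>.\<close>

lemma packing_necessary:
  fixes D :: "('v, 'e) dypergraph"
  assumes D: "dypergraph D" and pack: "hyperbranching_packing D k B S"
    and reg: "regular_packing D h k B S" and P: "subpartition (hverts D) P"
  shows "h * card P \<le> (\<Sum>i=1..k. min (card (S i)) (card P)) + entering_count D P"
proof -
  define K where "K = {1..k}"
  have finK: "finite K" by (simp add: K_def)
  have finP: "finite P" using subpartition_finite P D by (auto simp: dypergraph_def)
  have B: "subdypergraph (B i) D" "hyperbranching (B i) (S i)" if "i \<in> K" for i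
    using pack that by (auto simp: hyperbranching_packing_def K_def)
  have finS: "finite (S i)" if "i \<in> K" for i
    using B(2)[OF that] finite_subset by (auto simp: hyperbranching_def dypergraph_def)
  have one: "h \<le> card {i \<in> K. X \<inter> S i \<noteq> {}} + entering D (hyperarcs D) X" if X: "X \<in> P" for X
  proof -
    obtain x where x: "x \<in> X" "x \<in> hverts D"
      using X P unfolding subpartition_def by (metis Sup_upper ex_in_conv subsetD)
    define J where "J = {i \<in> K. x \<in> core (B i) (S i) \<and> X \<inter> S i = {}}"
    have "h = card {i \<in> K. x \<in> core (B i) (S i)}"
      using reg x(2) by (simp add: regular_packing_def K_def)
    also have "\<dots> \<le> card ({i \<in> K. X \<inter> S i \<noteq> {}} \<union> J)"
      using finK by (intro card_mono) (auto simp: J_def)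
    also have "\<dots> \<le> card {i \<in> K. X \<inter> S i \<noteq> {}} + card J" by (rule card_Un_le)
    also have "card J \<le> entering D (hyperarcs D) X"
    proof -
      have "\<exists>e. e \<in> hyperarcs (B i) \<and> enters (B i) e X" if "i \<in> J" for i
        using hyperbranching_entered[OF B(2), of i x X] that x(1) unfolding J_def by blast
      then obtain a where a: "\<And>i. i \<in> J \<Longrightarrow> a i \<in> hyperarcs (B i) \<and> enters (B i) (a i) X" by metis
      have aD: "a i \<in> hyperarcs D \<and> enters D (a i) X" if "i \<in> J" for i
        using a[OF that] B(1)[of i] that by (auto simp: J_def subdypergraph_def enters_def)
      have "disjoint_family_on (\<lambda>i. hyperarcs (B i)) K"
        using pack by (simp add: hyperbranching_packing_def K_def)
      then have "inj_on a J"
        using a unfolding disjoint_family_on_def J_def inj_on_def by (metis (mono_tags, lifting) IntI empty_iff mem_Collect_eq)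
      then show ?thesis
        unfolding entering_def
        by (rule card_inj_on_le) (use aD D in \<open>auto simp: dypergraph_def\<close>)
    qed
    finally show ?thesis by simp
  qed
  have "h * card P = (\<Sum>X\<in>P. h)" by simp
  also have "\<dots> \<le> (\<Sum>X\<in>P. card {i \<in> K. X \<inter> S i \<noteq> {}} + entering D (hyperarcs D) X)"
    by (rule sum_mono) (rule one)
  also have "\<dots> = (\<Sum>X\<in>P. card {i \<in> K. X \<inter> S i \<noteq> {}}) + entering_count D P"
    by (simp add: sum.distrib entering_count_eq_sum[OF D P])
  also have "(\<Sum>X\<in>P. card {i \<in> K. X \<inter> S i \<noteq> {}}) = (\<Sum>i\<in>K. hits (S i) P)"
    by (rule sum_multicount_gen) (use finP finK in \<open>auto simp: hits_def\<close>)
  also have "\<dots> \<le> (\<Sum>i\<in>K. min (card (S i)) (card P))"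
  proof (rule sum_mono)
    fix i assume "i \<in> K"
    have "hits (S i) P \<le> card P" unfolding hits_def using finP by (intro card_mono) auto
    then show "hits (S i) P \<le> min (card (S i)) (card P)"
      using hits_le_card[OF P finS[OF \<open>i \<in> K\<close>]] by simp
  qed
  finally show ?thesis by (simp add: K_def)
qed

text \<open>The amount that truncation at \<open>n\<close> takes away from \<open>l\<close> is a convex function of \<open>n\<close>. It is at
  most \<open>h * N\<close> at \<open>n = 0\<close> and vanishes at \<open>n = N\<close>, so it lies below the chord \<open>h * (N - n)\<close>.\<close>

lemma convex_deficit:
  fixes l :: "'i \<Rightarrow> nat"
  assumes "finite K" "N > 0" "n \<le> N" "\<And>i. i \<in> K \<Longrightarrow> l i \<le> N" "sum l K \<le> h * N"
  shows "h * n + sum l K \<le> h * N + (\<Sum>i\<in>K. min (l i) n)"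
proof -
  have "(int (l i) - int (min (l i) n)) * int N \<le> int (l i) * (int N - int n)" if "i \<in> K" for i
  proof (cases "l i \<le> n")
    case False
    have "int n * int (l i) \<le> int n * int N" using assms(4)[OF that] by (intro mult_left_mono) auto
    with False show ?thesis by (simp add: algebra_simps)
  qed (use assms(3) in simp)
  then have "(\<Sum>i\<in>K. (int (l i) - int (min (l i) n)) * int N) \<le> (\<Sum>i\<in>K. int (l i) * (int N - int n))"
    by (rule sum_mono)
  then have "(int (sum l K) - int (\<Sum>i\<in>K. min (l i) n)) * int N \<le> (\<Sum>i\<in>K. int (l i) * (int N - int n))"
    by (simp only: sum_distrib_right[symmetric] sum_subtractf of_nat_sum)
  also have "\<dots> = int (sum l K) * (int N - int n)" by (simp add: sum_distrib_right)
  also have "\<dots> \<le> int (h * N) * (int N - int n)"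
    using assms(3,5) by (intro mult_right_mono) (simp_all only: of_nat_le_iff diff_ge_0_iff_ge)
  finally have "(int (sum l K) - int (\<Sum>i\<in>K. min (l i) n)) * int N \<le> (int h * (int N - int n)) * int N"
    by (simp only: of_nat_mult mult.assoc mult.commute mult.left_commute)
  then have "int (sum l K) - int (\<Sum>i\<in>K. min (l i) n) \<le> int h * (int N - int n)"
    using \<open>N > 0\<close> by (simp add: mult_le_cancel_right del: of_nat_sum)
  then have "int (h * n + sum l K) \<le> int (h * N + (\<Sum>i\<in>K. min (l i) n))"
    by (simp add: algebra_simps del: of_nat_sum)
  then show ?thesis by (simp only: of_nat_le_iff)
qed

theorem theorem12:
  fixes D :: "('v, 'e) dypergraph"
    and h k \<alpha> \<beta> :: nat
    and l l' :: "nat \<Rightarrow> nat"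
  assumes "dypergraph D"
    and "h > 0" and "k > 0" and "\<alpha> > 0" and "\<beta> > 0"
    and "\<forall>i\<in>{1..k}. l i > 0 \<and> l' i > 0"
    and "(\<Sum>i=1..k. l' i) \<ge> \<beta>" and "\<beta> \<ge> \<alpha>" and "\<alpha> \<ge> (\<Sum>i=1..k. l i)"
    and "\<forall>i\<in>{1..k}. card (hverts D) \<ge> l' i \<and> l' i \<ge> l i"
  shows "(\<exists>B S. hyperbranching_packing D k B S \<and> regular_packing D h k B S \<and>
            bordered_packing l l' k S \<and> limited_packing \<alpha> \<beta> k S)
    \<longleftrightarrow>
      h * card (hverts D) \<ge> \<alpha> \<and>
      (\<forall>P. subpartition (hverts D) P \<longrightarrow>
         int \<beta> - int (\<Sum>i=1..k. l i) + int (\<Sum>i=1..k. min (l i) (card P))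
           + int (entering_count D P) \<ge> int (h * card P)) \<and>
      (\<forall>P. subpartition (hverts D) P \<longrightarrow>
         (\<Sum>i=1..k. min (l' i) (card P)) + entering_count D P \<ge> h * card P)"
  (is "?packing \<longleftrightarrow> ?enough \<and> ?lower \<and> ?upper")
proof
  have finV: "finite (hverts D)" using assms(1) by (simp add: dypergraph_def)
  assume ?packing
  then obtain B S where pack: "hyperbranching_packing D k B S" and reg: "regular_packing D h k B S"
    and bord: "bordered_packing l l' k S" and lim: "limited_packing \<alpha> \<beta> k S" by blast
  have size: "l i \<le> card (S i)" "card (S i) \<le> l' i" if "i \<in> {1..k}" for i
    using bord that by (auto simp: bordered_packing_def)
  have SV: "S i \<subseteq> hverts D" if "i \<in> {1..k}" for i
    using pack that by (fastforce simp: hyperbranching_packing_def hyperbranching_def subdypergraph_def)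
  have "(\<Sum>i=1..k. card (S i)) = (\<Sum>v\<in>hverts D. card {i \<in> {1..k}. v \<in> S i})"
    using sum_degrees[OF finV, of "{1..k}" S] SV by simp
  also have "\<dots> \<le> (\<Sum>v\<in>hverts D. h)"
  proof (rule sum_mono)
    fix v assume "v \<in> hverts D"
    then have "h = card {i \<in> {1..k}. v \<in> core (B i) (S i)}" using reg by (simp add: regular_packing_def)
    moreover have "card {i \<in> {1..k}. v \<in> S i} \<le> card {i \<in> {1..k}. v \<in> core (B i) (S i)}"
      by (rule card_mono) (auto simp: core_def)
    ultimately show "card {i \<in> {1..k}. v \<in> S i} \<le> h" by simp
  qed
  finally have ?enough using lim by (simp add: limited_packing_def mult.commute)
  moreover have ?lower
  proof (intro allI impI)
    fix P assume P: "subpartition (hverts D) P"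
    have "(\<Sum>i=1..k. min (card (S i)) (card P) + l i) \<le> (\<Sum>i=1..k. card (S i) + min (l i) (card P))"
    proof (rule sum_mono)
      fix i assume "i \<in> {1..k}"
      then show "min (card (S i)) (card P) + l i \<le> card (S i) + min (l i) (card P)"
        using size(1)[of i] by (simp add: min_def)
    qed
    then have "(\<Sum>i=1..k. min (card (S i)) (card P)) + sum l {1..k} \<le> \<beta> + (\<Sum>i=1..k. min (l i) (card P))"
      using lim by (simp add: sum.distrib limited_packing_def)
    then show "int (h * card P) \<le> int \<beta> - int (\<Sum>i=1..k. l i) + int (\<Sum>i=1..k. min (l i) (card P))
           + int (entering_count D P)"
      using packing_necessary[OF assms(1) pack reg P] by linarith
  qed
  moreover have ?upper
  proof (intro allI impI)
    fix P assume P: "subpartition (hverts D) P"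
    have "(\<Sum>i=1..k. min (card (S i)) (card P)) \<le> (\<Sum>i=1..k. min (l' i) (card P))"
      by (intro sum_mono min.mono) (use size(2) in auto)
    then show "h * card P \<le> (\<Sum>i=1..k. min (l' i) (card P)) + entering_count D P"
      using packing_necessary[OF assms(1) pack reg P] by linarith
  qed
  ultimately show "?enough \<and> ?lower \<and> ?upper" by blast
next
  define V where "V = hverts D"
  define K where "K = {1..k}"
  define N where "N = card V"
  have finV: "finite V" and finA: "finite (hyperarcs D)" and "V \<noteq> {}"
    using assms(1) by (simp_all add: dypergraph_def V_def)
  then have N: "N > 0" by (simp add: N_def card_gt_0_iff)
  have finK: "finite K" by (simp add: K_def)
  assume conds: "?enough \<and> ?lower \<and> ?upper"
  \<comment> \<open>The total number of roots: no more than \<open>h * N\<close> of them fit when every vertex has degree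
    at most \<open>h\<close>.\<close>
  define s where "s = min \<beta> (h * N)"
  have s: "\<alpha> \<le> s" "s \<le> \<beta>" "s \<le> h * N" "sum l K \<le> s" "s \<le> sum l' K"
    using conds assms(7-9) by (auto simp: s_def N_def V_def K_def)
  have l: "l i \<le> l' i" "l' i \<le> N" "0 < l i" if "i \<in> K" for i
    using assms(6,10) that by (auto simp: K_def N_def V_def)
  obtain m where m: "\<And>i. i \<in> K \<Longrightarrow> l i \<le> m i \<and> m i \<le> l' i" "sum m K = s"
    "\<And>n. (\<Sum>i\<in>K. min (m i) n) = (\<Sum>i\<in>K. min (l' i) n) \<or>
      (\<Sum>i\<in>K. min (m i) n) + sum l K = s + (\<Sum>i\<in>K. min (l i) n)"
    using balanced_sizes[OF finK l(1) s(4,5)] by blast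
  define p where "p X = int h - int (entering D (hyperarcs D) X)" for X
  have p: "intersecting_submodular V (\<lambda>X. - p X)"
    unfolding intersecting_submodular_def
  proof (intro allI impI)
    fix X Y :: "'v set"
    show "- p (X \<union> Y) + - p (X \<inter> Y) \<le> - p X + - p Y"
      using entering_submodular[OF finA, of D X Y] by (simp add: p_def)
  qed
  have p_sum: "sum p P = int (h * card P) - int (entering_count D P)" if "subpartition V P" for P
    using entering_count_eq_sum[OF assms(1)] that
    by (simp add: p_def V_def sum_subtractf)
  have cover: "sum p P \<le> (\<Sum>i\<in>K. int (min (m i) (card P)))" if P: "subpartition V P" for P
  proof -
    define n where "n = card P"
    have n: "n \<le> N" using card_subpartition_le[OF finV P] by (simp add: n_def N_def)
    have "h * n \<le> (\<Sum>i\<in>K. min (m i) n) + entering_count D P"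
      using m(3)[of n]
    proof
      assume "(\<Sum>i\<in>K. min (m i) n) = (\<Sum>i\<in>K. min (l' i) n)"
      then show ?thesis using conds P by (simp add: n_def K_def V_def)
    next
      assume eq: "(\<Sum>i\<in>K. min (m i) n) + sum l K = s + (\<Sum>i\<in>K. min (l i) n)"
      show ?thesis
      proof (cases "s = \<beta>")
        case True
        have "int (h * n) \<le> int \<beta> - int (sum l K) + int (\<Sum>i\<in>K. min (l i) n) + int (entering_count D P)"
          using conds P by (simp add: n_def K_def V_def)
        then show ?thesis using eq True by linarith
      next
        case False
        then have "s = h * N" by (auto simp: s_def min_def split: if_splits)
        moreover have "h * n + sum l K \<le> h * N + (\<Sum>i\<in>K. min (l i) n)"
        proof (rule convex_deficit[OF finK N n])
          show "l i \<le> N" if "i \<in> K" for i using l(1,2)[OF that] by simp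
          show "sum l K \<le> h * N" using s(3,4) by simp
        qed
        ultimately show ?thesis using eq by linarith
      qed
    qed
    then have "int (h * n) - int (entering_count D P) \<le> int (\<Sum>i\<in>K. min (m i) n)" by linarith
    then show ?thesis unfolding p_sum[OF P] n_def by simp
  qed
  have "m i \<le> card V" if "i \<in> K" for i using m(1)[OF that] l(2)[OF that] by (simp add: N_def)
  then obtain R where R: "\<And>i. i \<in> K \<Longrightarrow> R i \<subseteq> V \<and> card (R i) = m i"
    "\<And>X. X \<subseteq> V \<Longrightarrow> X \<noteq> {} \<Longrightarrow> p X \<le> int (card {i \<in> K. X \<inter> R i \<noteq> {}})"
    using root_sets[OF finV finK p _ cover] by blast
  have R_sum: "(\<Sum>i\<in>K. card (R i)) \<le> h * card V" using R(1) m(2) s(3) by (simp add: N_def)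
  have p_le: "p X \<le> int h" for X by (simp add: p_def)
  obtain S where S: "\<And>i. i \<in> K \<Longrightarrow> S i \<subseteq> V \<and> card (S i) = card (R i)"
    "\<And>v. v \<in> V \<Longrightarrow> card {i \<in> K. v \<in> S i} \<le> h"
    "\<And>X. X \<subseteq> V \<Longrightarrow> X \<noteq> {} \<Longrightarrow> p X \<le> int (card {i \<in> K. X \<inter> S i \<noteq> {}})"
    by (rule bounded_degree_cover[OF finV finK, of R h p]) (use R R_sum p_le in blast)+
  have Sm: "card (S i) = m i" if "i \<in> K" for i using S(1) R(1) that by simp
  obtain B where B: "hyperbranching_packing D k B S" "regular_packing D h k B S"
  proof (rule packing_with_given_roots[OF assms(1)])
    fix i assume "i \<in> {1..k}"
    then have i: "i \<in> K" by (simp add: K_def)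
    then have "card (S i) > 0" using Sm m(1) l(3) by fastforce
    then show "S i \<subseteq> hverts D \<and> S i \<noteq> {}" using S(1)[OF i] by (auto simp: V_def)
  next
    fix v assume "v \<in> hverts D"
    then show "card {i \<in> {1..k}. v \<in> S i} \<le> h" using S(2) by (simp add: V_def K_def)
  next
    fix X assume "X \<subseteq> hverts D" "X \<noteq> {}"
    then show "h \<le> entering D (hyperarcs D) X + card {i \<in> {1..k}. X \<inter> S i \<noteq> {}}"
      using S(3)[of X] by (simp add: V_def K_def p_def)
  qed
  have "bordered_packing l l' k S" using Sm m(1) by (simp add: bordered_packing_def K_def)
  moreover have "limited_packing \<alpha> \<beta> k S"
    using Sm m(2) s(1,2) by (simp add: limited_packing_def K_def)
  ultimately show ?packing using B by blast
qed

end
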